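(* There exist $n\ge 1$ and symmetric positive definite $n\times n$ real matrices $A$ and $B$ such that, for the Gaussian probability measures $\mu$ and $\nu$ on $\mathbb{R}^n$ given by $$\frac{d\mu}{dx}=\frac{\sqrt{\det(A)}}{(2\pi)^{n/2}}\exp\left(-\tfrac12 x^\intercal A x\right),\qquad \frac{d\nu}{d\mu}(x)=c_0\exp\left(-\tfrac12 x^\intercal Bx\right)$$ (with $c_0>0$ the constant making $\nu$ a probability measure), the Kim-Milman heat flow transport map $T$ pushing $\mu$ forward to $\nu$ does not coincide with the Brenier map pushing $\mu$ forward to $\nu$; that is, it is not the case that $T=\nabla\varphi$ $\mu$-almost everywhere, where $\nabla\varphi$ denotes the Brenier map.
   Context: A Borel map $T:\mathbb{R}^n\to\mathbb{R}^n$ pushes $\mu$ forward to $\nu$, written $T_{\#}\mu=\nu$, if $\mu(T^{-1}(\Omega))=\nu(\Omega)$ for every Borel set $\Omega\subset\mathbb{R}^n$. Brenier map. For Borel probability measures $\mu,\nu$ on $\mathbb{R}^n$ with $\mu$ absolutely continuous with respect to Lebesgue measure, the Brenier map from $\mu$ to $\nu$ is the map, unique up to a $\mu$-nullset, of the form $\nabla\varphi$ with $\varphi$ convex and $(\nabla\varphi)_{\#}\mu=\nu$. (When $\mu,\nu$ have finite second moments it is the optimal transport map for the quadratic cost $\|x-y\|^2$.) Kim-Milman heat flow map (for the Gaussian measures in the claim). Let $f(x)=\frac{d\nu}{d\mu}(x)=c_0\exp(-\frac12 x^\intercal Bx)$. Let $L=\Delta-Ax\cdot\nabla$, and let $P^A_t$,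 $t\ge 0$, be the semigroup with generator $L$, i.e. $\frac{d}{dt}P^A_t(f)=L(P^A_t(f))$, $P^A_0(f)=f$. It is given explicitly by the Mehler formula $$P^A_t(f)(x)=\int_{\mathbb{R}^n} f\left(\exp(-tA)x+\sqrt{\mathrm{Id}-\exp(-2tA)}\,y\right)d\mu(y).$$ Define the velocity field $w_t(x)=-\nabla\log P^A_t(f)(x)$ and let $S_t:\mathbb{R}^n\to\mathbb{R}^n$, $t\ge0$, be its flow, i.e. the solution of $$\frac{d}{dt}S_t(x)=w_t(S_t(x)),\qquad S_0(x)=x.$$ For these Gaussian measures $w_t$ is linear in $x$, the flow exists uniquely for all $t\in[0,\infty)$ and all $x\in\mathbb{R}^n$, each $S_t$ is an invertible linear map, and $S_{t\#}\nu=\nu_t$, where $d\nu_t=P^A_t(f)\,d\mu$. The Kim-Milman map $T$ from $\mu$ to $\nu$ is the limit, uniform on compact sets, of the inverse maps $T_t=S_t^{-1}$ as $t\to\infty$; it satisfies $T_{\#}\mu=\nu$. *)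

theory Defs
  imports "HOL-Probability.Probability" "Jordan_Normal_Form.Matrix" "Jordan_Normal_Form.Determinant"
begin

text \<open>
  The dimension \<open>n\<close> is bound inside the statements, so \<open>\<real>\<^sup>n\<close> is \<open>carrier_vec n\<close> and
  matrices are elements of \<open>carrier_mat n n\<close>, with \<open>\<bullet>\<close> the dot product \<open>scalar_prod\<close>.
  Topological and analytic notions on \<open>\<real>\<^sup>n\<close> are therefore spelled out relative to this carrier;
  maps and functions are arbitrary outside of it.
\<close>

unbundle no inner_syntax
unbundle no vec_syntax
hide_const (open) Finite_Cartesian_Product.vec Determinants.det


section \<open>Matrices\<close>

definition pos_semidef_mat :: "nat \<Rightarrow> real mat \<Rightarrow> bool" where
  "pos_semidef_mat n M \<longleftrightarrow> M \<in> carrier_mat n n \<and> transpose_mat M = M \<and>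
     (\<forall>v\<in>carrier_vec n. 0 \<le> v \<bullet> (M *\<^sub>v v))"

definition pos_def_mat :: "nat \<Rightarrow> real mat \<Rightarrow> bool" where
  "pos_def_mat n M \<longleftrightarrow> M \<in> carrier_mat n n \<and> transpose_mat M = M \<and>
     (\<forall>v\<in>carrier_vec n. v \<noteq> 0\<^sub>v n \<longrightarrow> 0 < v \<bullet> (M *\<^sub>v v))"

definition mat_exp :: "nat \<Rightarrow> real mat \<Rightarrow> real mat" where
  "mat_exp n M = mat n n (\<lambda>(i, j). \<Sum>k. (M ^\<^sub>m k) $$ (i, j) / fact k)"

definition mat_sqrt :: "nat \<Rightarrow> real mat \<Rightarrow> real mat" where
  "mat_sqrt n M = (THE R. pos_semidef_mat n R \<and> R * R = M)"


section \<open>Analysis on \<open>carrier_vec n\<close>\<close>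

definition vec_norm2 :: "real vec \<Rightarrow> real" where
  "vec_norm2 v = sqrt (v \<bullet> v)"

definition compact_vec :: "nat \<Rightarrow> real vec set \<Rightarrow> bool" where
  "compact_vec n K \<longleftrightarrow> K \<subseteq> carrier_vec n \<and> compact ((\<lambda>v i. if i < n then v $ i else 0) ` K)"
    \<comment> \<open>compactness in the product topology of \<open>nat \<Rightarrow> real\<close>, padding the coordinates with zeros\<close>

definition has_gradient_vec :: "nat \<Rightarrow> (real vec \<Rightarrow> real) \<Rightarrow> real vec \<Rightarrow> real vec \<Rightarrow> bool" where
  "has_gradient_vec n f g x \<longleftrightarrow> g \<in> carrier_vec n \<and> x \<in> carrier_vec n \<and>
     (\<forall>\<epsilon>>0. \<exists>\<delta>>0. \<forall>y\<in>carrier_vec n. vec_norm2 (y - x) < \<delta> \<longrightarrow>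
        \<bar>f y - f x - g \<bullet> (y - x)\<bar> \<le> \<epsilon> * vec_norm2 (y - x))"

definition gradient_vec :: "nat \<Rightarrow> (real vec \<Rightarrow> real) \<Rightarrow> real vec \<Rightarrow> real vec" where
  "gradient_vec n f x = (THE g. has_gradient_vec n f g x)"

definition convex_fun_vec :: "nat \<Rightarrow> (real vec \<Rightarrow> real) \<Rightarrow> bool" where
  "convex_fun_vec n \<phi> \<longleftrightarrow> (\<forall>x\<in>carrier_vec n. \<forall>y\<in>carrier_vec n. \<forall>t\<in>{0..1}.
     \<phi> ((1 - t) \<cdot>\<^sub>v x + t \<cdot>\<^sub>v y) \<le> (1 - t) * \<phi> x + t * \<phi> y)"


section \<open>Measures on \<open>carrier_vec n\<close>\<close>

text \<open>Lebesgue measure on the Borel sets of \<open>\<real>\<^sup>n\<close>: the \<open>n\<close>-fold product, transported along the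
  coordinate bijection \<open>({..<n} \<rightarrow>\<^sub>E UNIV) \<cong> carrier_vec n\<close>.\<close>

definition lborel_vec :: "nat \<Rightarrow> real vec measure" where
  "lborel_vec n = embed_measure (Pi\<^sub>M {..<n} (\<lambda>_. lborel)) (Matrix.vec n)"

definition gaussian_vec :: "nat \<Rightarrow> real mat \<Rightarrow> real vec measure" where
  "gaussian_vec n A = density (lborel_vec n)
     (\<lambda>x. ennreal (sqrt (Determinant.det A) / (2 * pi) powr (real n / 2) *
                     exp (- (1/2) * (x \<bullet> (A *\<^sub>v x)))))"

definition gaussian_tilt :: "real \<Rightarrow> real mat \<Rightarrow> real vec \<Rightarrow> real" where
  "gaussian_tilt c\<^sub>0 B x = c\<^sub>0 * exp (- (1/2) * (x \<bullet> (B *\<^sub>v x)))"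


section \<open>Brenier maps\<close>

text \<open>A Brenier map is determined up to a \<open>\<mu>\<close>-null set only, and the gradient of a convex function
  exists almost everywhere; \<open>G\<close> is a Borel representative of \<open>\<nabla>\<phi>\<close>.\<close>

definition is_brenier_map ::
  "nat \<Rightarrow> real vec measure \<Rightarrow> real vec measure \<Rightarrow> (real vec \<Rightarrow> real vec) \<Rightarrow> bool" where
  "is_brenier_map n \<mu> \<nu> G \<longleftrightarrow>
     G \<in> measurable (lborel_vec n) (lborel_vec n) \<and>
     (\<exists>\<phi>. convex_fun_vec n \<phi> \<and> (AE x in \<mu>. has_gradient_vec n \<phi> (G x) x)) \<and>
     distr \<mu> (lborel_vec n) G = \<nu>"


section \<open>The Kim-Milman heat flow map\<close>

text \<open>The Ornstein-Uhlenbeck semigroup with generator \<open>\<Delta> - Ax \<cdot> \<nabla>\<close>, by the Mehler formula.\<close>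

definition ou_semigroup ::
  "nat \<Rightarrow> real mat \<Rightarrow> real \<Rightarrow> (real vec \<Rightarrow> real) \<Rightarrow> real vec \<Rightarrow> real" where
  "ou_semigroup n A t f x =
     (\<integral>y. f (mat_exp n ((- t) \<cdot>\<^sub>m A) *\<^sub>v x +
             mat_sqrt n (1\<^sub>m n - mat_exp n ((- 2 * t) \<cdot>\<^sub>m A)) *\<^sub>v y) \<partial>gaussian_vec n A)"

definition heat_velocity ::
  "nat \<Rightarrow> real mat \<Rightarrow> (real vec \<Rightarrow> real) \<Rightarrow> real \<Rightarrow> real vec \<Rightarrow> real vec" where
  "heat_velocity n A f t x = - gradient_vec n (\<lambda>y. ln (ou_semigroup n A t f y)) x"

definition is_flow_vec ::
  "nat \<Rightarrow> (real \<Rightarrow> real vec \<Rightarrow> real vec) \<Rightarrow> (real \<Rightarrow> real vec \<Rightarrow> real vec) \<Rightarrow> bool" where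
  "is_flow_vec n w S \<longleftrightarrow> (\<forall>x\<in>carrier_vec n.
     S 0 x = x \<and>
     (\<forall>t\<ge>0. S t x \<in> carrier_vec n \<and>
        (\<forall>i<n. ((\<lambda>s. S s x $ i) has_real_derivative w t (S t x) $ i) (at t within {0..}))))"

definition is_kim_milman_map ::
  "nat \<Rightarrow> real mat \<Rightarrow> (real vec \<Rightarrow> real) \<Rightarrow> (real vec \<Rightarrow> real vec) \<Rightarrow> bool" where
  "is_kim_milman_map n A f T \<longleftrightarrow> T \<in> carrier_vec n \<rightarrow> carrier_vec n \<and>
     (\<exists>S. is_flow_vec n (heat_velocity n A f) S \<and>
          (\<forall>t\<ge>0. bij_betw (S t) (carrier_vec n) (carrier_vec n)) \<and>
          (\<forall>K. compact_vec n K \<longrightarrow>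
             uniform_limit K (\<lambda>t x. vec_norm2 (inv_into (carrier_vec n) (S t) x - T x))
               (\<lambda>_. 0) at_top))"

end

theory Submission
  imports Defs
begin

text \<open>
  Take \<open>n = 2\<close>, \<open>A = diag (1, 2)\<close> and a matrix \<open>B\<close> that does not commute with \<open>A\<close>. The velocity
  field is linear, \<open>w\<^sub>t(x) = M\<^sub>t x\<close> with \<open>M\<^sub>t\<close> symmetric, so the Kim-Milman map is \<open>S\<inverse>\<close> for the limit
  \<open>S\<close> of the solution of \<open>S' = M\<^sub>t S\<close>, \<open>S\<^sub>0 = 1\<close>. The eigenvectors of \<open>M\<^sub>t\<close> rotate monotonically with
  \<open>t\<close>, and \<open>S\<close> picks up a nonzero antisymmetric part from this. A linear map that agrees almost
  everywhere with the gradient of a convex function is symmetric, hence the two maps differ.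
\<close>

section \<open>Coordinates in the plane\<close>

text \<open>The limit of S is never evaluated: its rotation angle is an integral that is left as an
  antiderivative. Only the sign of the antisymmetric part is determined. With \<open>x\<close> half
  the difference of the diagonal entries of M, \<kappa> = M12 / \<open>x\<close> is the tangent of
  twice the eigenvector angle. Its strict growth turns the system for S, after a change of unknowns,
  into one with nonnegative coefficients, where signs propagate. The claim concerns every Kim-Milman
  map and every Brenier map and asserts that both exist. So the flow has to be exhibited, shown to
  be the only one, and shown to converge to an invertible limit. The numbers keep the algebra
  rational. The eigenvalues 1 and 2 of A give exp(-tA) = diag(r, r^2) with r = exp(-t), so
  covariances are polynomials in r. With B = [[2, -1], [-1, 1]], A + B = [[3, -1], [-1, 3]] has
  determinant 8, hence c0 = sqrt(8 / 2) = 2.\<close>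

definition vec2 :: "real \<times> real \<Rightarrow> real vec" where
  "vec2 p = Matrix.vec 2 (\<lambda>i. if i = 0 then fst p else snd p)"

definition mat2 :: "real \<Rightarrow> real \<Rightarrow> real \<Rightarrow> real \<Rightarrow> real mat" where
  "mat2 a b c d = mat 2 2 (\<lambda>(i, j). if i = 0 then if j = 0 then a else b else if j = 0 then c else d)"

lemma lessThan_2: "{..<2::nat} = {0, 1}"
  by auto

lemma vec2_carrier [simp]: "vec2 p \<in> carrier_vec 2" "dim_vec (vec2 p) = 2"
  by (simp_all add: vec2_def)

lemma vec2_index [simp]: "vec2 p $ 0 = fst p" "vec2 p $ Suc 0 = snd p"
  by (simp_all add: vec2_def)

lemma vec2_eqI: "v \<in> carrier_vec 2 \<Longrightarrow> v $ 0 = fst p \<Longrightarrow> v $ Suc 0 = snd p \<Longrightarrow> v = vec2 p"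
  by (rule eq_vecI) (auto simp: less_2_cases_iff)

lemma vec2_coords [simp]: "v \<in> carrier_vec 2 \<Longrightarrow> vec2 (v $ 0, v $ Suc 0) = v"
  by (rule vec2_eqI [symmetric]) auto

lemma carrier_vec_2_cases:
  assumes "v \<in> carrier_vec 2"
  obtains p where "v = vec2 p"
  using vec2_coords [OF assms] by metis

lemma vec2_eq_iff [simp]: "vec2 p = vec2 q \<longleftrightarrow> p = q"
  by (metis prod_eq_iff vec2_index)

lemma vec2_arith [simp]:
  "vec2 p + vec2 q = vec2 (p + q)" "vec2 p - vec2 q = vec2 (p - q)" "- vec2 p = vec2 (- p)"
  "k \<cdot>\<^sub>v vec2 p = vec2 (k *\<^sub>R p)" "0\<^sub>v 2 = vec2 0"
  by (auto intro!: vec2_eqI)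

lemma scalar_prod_vec2 [simp]: "vec2 p \<bullet> vec2 q = fst p * fst q + snd p * snd q"
  by (simp add: scalar_prod_def numeral_2_eq_2)

lemma vec_norm2_vec2 [simp]: "vec_norm2 (vec2 p) = norm p"
  by (cases p) (simp add: vec_norm2_def norm_Pair power2_eq_square)

lemma mat2_carrier [simp]: "mat2 a b c d \<in> carrier_mat 2 2"
  "dim_row (mat2 a b c d) = 2" "dim_col (mat2 a b c d) = 2"
  by (simp_all add: mat2_def)

lemma mat2_index [simp]:
  "mat2 a b c d $$ (0, 0) = a" "mat2 a b c d $$ (0, Suc 0) = b"
  "mat2 a b c d $$ (Suc 0, 0) = c" "mat2 a b c d $$ (Suc 0, Suc 0) = d"
  by (simp_all add: mat2_def)

lemma mat2_eqI:
  "M \<in> carrier_mat 2 2 \<Longrightarrow> M $$ (0, 0) = a \<Longrightarrow> M $$ (0, Suc 0) = b \<Longrightarrow>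
    M $$ (Suc 0, 0) = c \<Longrightarrow> M $$ (Suc 0, Suc 0) = d \<Longrightarrow> M = mat2 a b c d"
  by (rule eq_matI) (auto simp: less_2_cases_iff)

lemma carrier_mat_2_cases:
  assumes "M \<in> carrier_mat 2 2"
  obtains a b c d where "M = mat2 a b c d"
  using mat2_eqI [OF assms] by blast

lemma mat2_eq_iff [simp]: "mat2 a b c d = mat2 a' b' c' d' \<longleftrightarrow> a = a' \<and> b = b' \<and> c = c' \<and> d = d'"
  by (metis mat2_index)

lemma mat2_mult_vec2 [simp]:
  "mat2 a b c d *\<^sub>v vec2 p = vec2 (a * fst p + b * snd p, c * fst p + d * snd p)"
proof (rule vec2_eqI)
  show "mat2 a b c d *\<^sub>v vec2 p \<in> carrier_vec 2" by (rule mult_mat_vec_carrier) auto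
qed (auto simp: scalar_prod_def numeral_2_eq_2)

lemma mat2_mult [simp]: "mat2 a b c d * mat2 a' b' c' d' =
    mat2 (a * a' + b * c') (a * b' + b * d') (c * a' + d * c') (c * b' + d * d')"
  by (rule mat2_eqI) (auto simp: scalar_prod_def numeral_2_eq_2)

lemma mat2_arith [simp]:
  "mat2 a b c d - mat2 a' b' c' d' = mat2 (a - a') (b - b') (c - c') (d - d')"
  "k \<cdot>\<^sub>m mat2 a b c d = mat2 (k * a) (k * b) (k * c) (k * d)" "1\<^sub>m 2 = mat2 1 0 0 1"
  "transpose_mat (mat2 a b c d) = mat2 a c b d"
  by (auto intro!: mat2_eqI)

lemma det_mat2_diag [simp]: "Determinant.det (mat2 a 0 0 d) = a * d"
proof -
  have "upper_triangular (mat2 a 0 0 d)"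
    by (auto simp: upper_triangular_def less_2_cases_iff)
  then have "Determinant.det (mat2 a 0 0 d) = prod_list (diag_mat (mat2 a 0 0 d))"
    by (intro det_upper_triangular) auto
  then show ?thesis by (simp add: diag_mat_def numeral_2_eq_2)
qed

lemma ball_carrier_vec_2: "(\<forall>v\<in>carrier_vec 2. P v) \<longleftrightarrow> (\<forall>p. P (vec2 p))"
  by (metis carrier_vec_2_cases vec2_carrier(1))

lemma mat_exp_diag: "mat_exp 2 (mat2 a 0 0 d) = mat2 (exp a) 0 0 (exp d)"
proof -
  have pow: "mat2 a 0 0 d ^\<^sub>m k = mat2 (a ^ k) 0 0 (d ^ k)" for k
    by (induction k) (auto simp: mult.commute)
  have "(\<Sum>k. x ^ k / fact k) = exp x" for x :: real
    by (simp add: exp_def divide_inverse mult.commute)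
  then show ?thesis
    unfolding mat_exp_def pow by (intro mat2_eqI) auto
qed

lemma pos_semidef_mat2_iff:
  "pos_semidef_mat 2 (mat2 a b c d) \<longleftrightarrow>
    b = c \<and> (\<forall>x y. 0 \<le> a * x\<^sup>2 + 2 * b * x * y + d * y\<^sup>2)"
  by (auto simp: pos_semidef_mat_def ball_carrier_vec_2 algebra_simps power2_eq_square)

text \<open>\<open>mat_sqrt\<close> is a definite description, so uniqueness among all semidefinite
  roots, diagonal or not, is part of the claim.\<close>

lemma mat_sqrt_diag:
  assumes "0 \<le> a" "0 \<le> d"
  shows "mat_sqrt 2 (mat2 a 0 0 d) = mat2 (sqrt a) 0 0 (sqrt d)"
  unfolding mat_sqrt_def
proof (rule the_equality)
  show "pos_semidef_mat 2 (mat2 (sqrt a) 0 0 (sqrt d)) \<and>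
      mat2 (sqrt a) 0 0 (sqrt d) * mat2 (sqrt a) 0 0 (sqrt d) = mat2 a 0 0 d"
    using assms by (auto simp: pos_semidef_mat2_iff)
next
  fix R assume R: "pos_semidef_mat 2 R \<and> R * R = mat2 a 0 0 d"
  then obtain p q q' s where Req: "R = mat2 p q q' s"
    by (metis carrier_mat_2_cases pos_semidef_mat_def)
  have "q' = q" and nonneg: "0 \<le> p * x\<^sup>2 + 2 * q * x * y + s * y\<^sup>2" for x y
    using R unfolding Req pos_semidef_mat2_iff by auto
  have sq: "p * p + q * q = a" "q * (p + s) = 0" "q * q + s * s = d"
    using R unfolding Req \<open>q' = q\<close> by (auto simp: algebra_simps)
  have ps: "0 \<le> p" "0 \<le> s" using nonneg [of 1 0] nonneg [of 0 1] by auto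
  have "q = 0"
  proof (rule ccontr)
    assume "q \<noteq> 0"
    with sq(2) ps have "p = 0" "s = 0" by auto
    \<comment> \<open>With p = s = 0 the quadratic form at (1, -q) is -2 q^2 < 0.\<close>
    with nonneg [of 1 "- q"] \<open>q \<noteq> 0\<close> show False
      by (auto simp: mult_le_0_iff zero_le_mult_iff)
  qed
  with sq ps show "R = mat2 (sqrt a) 0 0 (sqrt d)"
    unfolding Req \<open>q' = q\<close> by (auto simp: real_sqrt_mult)
qed


section \<open>Lebesgue measure in the plane\<close>

lemma range_vec2: "vec2 ` UNIV = Matrix.vec 2 ` ({..<2} \<rightarrow>\<^sub>E (UNIV::real set))"
proof -
  have "vec2 p \<in> Matrix.vec 2 ` ({..<2} \<rightarrow>\<^sub>E (UNIV::real set))" for p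
    by (rule image_eqI [of _ _ "\<lambda>i\<in>{..<2}. if i = 0 then fst p else snd p"])
      (auto simp: vec2_def)
  moreover have "Matrix.vec 2 f \<in> range vec2" for f
    using vec2_coords [of "Matrix.vec 2 f"] by (metis rangeI vec_carrier)
  ultimately show ?thesis by auto
qed

lemma space_lborel_vec_2 [simp]: "space (lborel_vec 2) = carrier_vec 2"
proof -
  have "range vec2 = carrier_vec 2"
    by (metis carrier_vec_2_cases subsetI subset_antisym image_subset_iff rangeI vec2_carrier(1))
  then show ?thesis
    by (simp add: lborel_vec_def space_embed_measure space_PiM range_vec2)
qed

lemma inj_vec_lessThan_2: "inj_on (Matrix.vec 2) ({..<2} \<rightarrow>\<^sub>E (UNIV::real set))"
proof (rule inj_onI)
  fix f g :: "nat \<Rightarrow> real"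
  assume fg: "f \<in> {..<2} \<rightarrow>\<^sub>E UNIV" "g \<in> {..<2} \<rightarrow>\<^sub>E UNIV" and "Matrix.vec 2 f = Matrix.vec 2 g"
  then have "f i = g i" if "i < 2" for i using that by (metis index_vec)
  with fg show "f = g" by (intro PiE_ext) auto
qed

interpretation lborel_family: product_sigma_finite "\<lambda>_::nat. lborel :: real measure" ..

text \<open>Both measures agree on boxes, which determine a finite product measure.\<close>

lemma distr_lborel_PiM_2:
  "distr (lborel :: (real \<times> real) measure) (Pi\<^sub>M {..<2} (\<lambda>_. lborel))
     (\<lambda>p. \<lambda>i\<in>{..<2}. if i = 0 then fst p else snd p) = Pi\<^sub>M {..<2::nat} (\<lambda>_. lborel)"
    (is "distr _ ?P ?e = _")
proof (rule lborel_family.PiM_eqI)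
  have [measurable]: "?e \<in> measurable lborel ?P"
    by (rule measurable_restrict)
      (auto simp: less_2_cases_iff intro!: borel_measurable_continuous_onI continuous_intros)
  fix A :: "nat \<Rightarrow> real set" assume A: "\<And>i. i \<in> {..<2} \<Longrightarrow> A i \<in> sets lborel"
  have "?e p \<in> Pi\<^sub>E {..<2} A \<longleftrightarrow> fst p \<in> A 0 \<and> snd p \<in> A 1" for p
    unfolding restrict_PiE_iff lessThan_2 by simp
  then have "?e -` Pi\<^sub>E {..<2} A \<inter> space lborel = A 0 \<times> A 1"
    unfolding set_eq_iff vimage_def by (simp add: mem_Times_iff del: restrict_apply)
  moreover have "Pi\<^sub>E {..<2} A \<in> sets ?P"
    using A by (intro sets_PiM_I_finite) auto
  ultimately have "emeasure (distr lborel ?P ?e) (Pi\<^sub>E {..<2} A) = emeasure (lborel \<Otimes>\<^sub>M lborel) (A 0 \<times> A 1)"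
    by (simp add: emeasure_distr lborel_prod)
  also have "\<dots> = emeasure lborel (A 0) * emeasure lborel (A 1)"
    using A by (intro lborel.emeasure_pair_measure_Times) auto
  also have "\<dots> = (\<Prod>i\<in>{..<2}. emeasure lborel (A i))"
    by (simp add: numeral_2_eq_2)
  finally show "emeasure (distr lborel ?P ?e) (Pi\<^sub>E {..<2} A) = (\<Prod>i\<in>{..<2}. emeasure lborel (A i))" .
qed auto

text \<open>This moves integrals and null sets from \<open>carrier_vec 2\<close> to the Euclidean
  space \<open>real \<times> real\<close>, where the library's analysis applies.\<close>

lemma lborel_vec_2: "lborel_vec 2 = distr lborel (lborel_vec 2) vec2"
  and measurable_vec2 [measurable]: "vec2 \<in> measurable borel (lborel_vec 2)"
proof -
  let ?P = "Pi\<^sub>M {..<2::nat} (\<lambda>_. lborel :: real measure)"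
  let ?e = "\<lambda>p::real \<times> real. \<lambda>i\<in>{..<2::nat}. if i = 0 then fst p else snd p"
  have e: "?e \<in> measurable borel ?P"
    by (rule measurable_restrict)
      (auto simp: less_2_cases_iff intro!: borel_measurable_continuous_onI continuous_intros)
  have inj: "inj_on (Matrix.vec 2) (space ?P)"
    using inj_vec_lessThan_2 by (simp add: space_PiM)
  have v: "Matrix.vec 2 \<in> measurable ?P (lborel_vec 2)"
    unfolding lborel_vec_def by (rule measurable_embed_measure2' [OF inj])
  have comp: "Matrix.vec 2 \<circ> ?e = vec2"
    by (auto simp: fun_eq_iff vec2_def intro!: eq_vecI)
  show "vec2 \<in> measurable borel (lborel_vec 2)"
    unfolding comp [symmetric] using e v by (rule measurable_comp)
  have "lborel_vec 2 = distr ?P (lborel_vec 2) (Matrix.vec 2)"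
    using embed_measure_eq_distr' [OF inj] by (simp add: lborel_vec_def)
  also have "\<dots> = distr (distr lborel ?P ?e) (lborel_vec 2) (Matrix.vec 2)"
    by (simp only: distr_lborel_PiM_2)
  also have "\<dots> = distr lborel (lborel_vec 2) vec2"
    unfolding comp [symmetric] using e v by (intro distr_distr) auto
  finally show "lborel_vec 2 = distr lborel (lborel_vec 2) vec2" .
qed

lemma measurable_vec_index [measurable]:
  assumes "i < n"
  shows "(\<lambda>v. v $ i) \<in> borel_measurable (lborel_vec n)"
  unfolding lborel_vec_def
proof (rule measurable_embed_measure1)
  have "(\<lambda>f. f i) \<in> borel_measurable (Pi\<^sub>M {..<n} (\<lambda>_. lborel :: real measure))"
    unfolding measurable_cong_sets [OF refl sets_lborel [symmetric]]
    using assms by (intro measurable_component_singleton) simp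
  then show "(\<lambda>f. Matrix.vec n f $ i) \<in> borel_measurable (Pi\<^sub>M {..<n} (\<lambda>_. lborel :: real measure))"
    using assms by simp
qed


lemma measurable_lborel_vec_2I:
  assumes "(\<lambda>p. F (vec2 p)) \<in> measurable borel N"
  shows "F \<in> measurable (lborel_vec 2) N"
proof -
  have "(\<lambda>v. (v $ 0, v $ Suc 0)) \<in> borel_measurable (lborel_vec 2)"
    by (intro borel_measurable_Pair measurable_vec_index) auto
  from measurable_compose [OF this assms]
  have "(\<lambda>v. F (vec2 (v $ 0, v $ Suc 0))) \<in> measurable (lborel_vec 2) N" .
  then show ?thesis
    by (subst (asm) measurable_cong [where g = F]) auto
qed

section \<open>Linear change of variables in the plane\<close>

lemma nn_integral_affine_fst:
  fixes F :: "real \<times> real \<Rightarrow> ennreal"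
  assumes [measurable]: "F \<in> borel_measurable borel" and "k \<noteq> 0"
  shows "(\<integral>\<^sup>+p. F p \<partial>lborel) = ennreal \<bar>k\<bar> * (\<integral>\<^sup>+p. F (k * fst p + s * snd p, snd p) \<partial>lborel)"
proof -
  have [measurable]: "F \<in> borel_measurable (borel \<Otimes>\<^sub>M borel)" by (simp add: borel_prod)
  have "(\<integral>\<^sup>+p. F p \<partial>(lborel \<Otimes>\<^sub>M lborel)) = (\<integral>\<^sup>+y. (\<integral>\<^sup>+x. F (x, y) \<partial>lborel) \<partial>lborel)"
    by (rule lborel_pair.nn_integral_snd [symmetric]) simp
  also have "\<dots> = (\<integral>\<^sup>+y. ennreal \<bar>k\<bar> * (\<integral>\<^sup>+x. F (s * y + k * x, y) \<partial>lborel) \<partial>lborel)"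
    using \<open>k \<noteq> 0\<close> by (intro nn_integral_cong nn_integral_real_affine) auto
  also have "\<dots> = ennreal \<bar>k\<bar> * (\<integral>\<^sup>+y. (\<integral>\<^sup>+x. F (s * y + k * x, y) \<partial>lborel) \<partial>lborel)"
    by (rule nn_integral_cmult) simp
  also have "(\<integral>\<^sup>+y. (\<integral>\<^sup>+x. F (s * y + k * x, y) \<partial>lborel) \<partial>lborel) =
      (\<integral>\<^sup>+p. F (s * snd p + k * fst p, snd p) \<partial>(lborel \<Otimes>\<^sub>M lborel))"
    by (subst lborel_pair.nn_integral_snd [symmetric]) simp_all
  finally show ?thesis by (simp add: lborel_prod add.commute)
qed

lemma nn_integral_affine_snd:
  fixes F :: "real \<times> real \<Rightarrow> ennreal"
  assumes [measurable]: "F \<in> borel_measurable borel" and "k \<noteq> 0"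
  shows "(\<integral>\<^sup>+p. F p \<partial>lborel) = ennreal \<bar>k\<bar> * (\<integral>\<^sup>+p. F (fst p, s * fst p + k * snd p) \<partial>lborel)"
proof -
  have [measurable]: "F \<in> borel_measurable (borel \<Otimes>\<^sub>M borel)" by (simp add: borel_prod)
  have "(\<integral>\<^sup>+p. F p \<partial>(lborel \<Otimes>\<^sub>M lborel)) = (\<integral>\<^sup>+x. (\<integral>\<^sup>+y. F (x, y) \<partial>lborel) \<partial>lborel)"
    by (rule lborel.nn_integral_fst [symmetric]) simp
  also have "\<dots> = (\<integral>\<^sup>+x. ennreal \<bar>k\<bar> * (\<integral>\<^sup>+y. F (x, s * x + k * y) \<partial>lborel) \<partial>lborel)"
    using \<open>k \<noteq> 0\<close> by (intro nn_integral_cong nn_integral_real_affine) auto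
  also have "\<dots> = ennreal \<bar>k\<bar> * (\<integral>\<^sup>+x. (\<integral>\<^sup>+y. F (x, s * x + k * y) \<partial>lborel) \<partial>lborel)"
    by (rule nn_integral_cmult) simp
  also have "(\<integral>\<^sup>+x. (\<integral>\<^sup>+y. F (x, s * x + k * y) \<partial>lborel) \<partial>lborel) =
      (\<integral>\<^sup>+p. F (fst p, s * fst p + k * snd p) \<partial>(lborel \<Otimes>\<^sub>M lborel))"
    by (subst lborel.nn_integral_fst [symmetric]) simp_all
  finally show ?thesis by (simp add: lborel_prod)
qed

text \<open>The matrix is factored into shears and dilations, which reduces the substitution to one
  variable at a time; this is where \<open>a \<noteq> 0\<close> enters.\<close>

lemma nn_integral_linear_2:
  fixes F :: "real \<times> real \<Rightarrow> ennreal"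
  assumes F [measurable]: "F \<in> borel_measurable borel" and "a \<noteq> 0" and det: "a * d - b * c \<noteq> 0"
  shows "(\<integral>\<^sup>+p. F p \<partial>lborel) =
    ennreal \<bar>a * d - b * c\<bar> * (\<integral>\<^sup>+p. F (a * fst p + b * snd p, c * fst p + d * snd p) \<partial>lborel)"
proof -
  \<comment> \<open>The second pivot: the matrix is [[a, 0], [c, e]] times the shear [[1, b/a],
    [0, 1]].\<close>
  define e where "e = (a * d - b * c) / a"
  have "e \<noteq> 0" using assms by (simp add: e_def)
  have prod_borel: "borel_measurable (borel :: (real \<times> real) measure) = borel_measurable (borel \<Otimes>\<^sub>M borel)"
    by (simp add: borel_prod)
  have [measurable]: "F \<in> borel_measurable (borel \<Otimes>\<^sub>M borel)" by (simp add: borel_prod)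
  have "(\<integral>\<^sup>+p. F p \<partial>lborel) = ennreal \<bar>a\<bar> * (\<integral>\<^sup>+p. F (a * fst p, snd p) \<partial>lborel)"
    using nn_integral_affine_fst [OF F \<open>a \<noteq> 0\<close>, of 0] by simp
  also have "(\<integral>\<^sup>+p. F (a * fst p, snd p) \<partial>lborel) =
      ennreal \<bar>e\<bar> * (\<integral>\<^sup>+p. F (a * fst p, c * fst p + e * snd p) \<partial>lborel)"
    by (subst nn_integral_affine_snd [OF _ \<open>e \<noteq> 0\<close>, where s = c]) (simp_all add: prod_borel)
  also have "(\<integral>\<^sup>+p. F (a * fst p, c * fst p + e * snd p) \<partial>lborel) =
      (\<integral>\<^sup>+p. F (a * (fst p + b / a * snd p), c * (fst p + b / a * snd p) + e * snd p) \<partial>lborel)"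
    by (subst nn_integral_affine_fst [where k = 1 and s = "b / a"]) (simp_all add: prod_borel)
  also have "\<dots> = (\<integral>\<^sup>+p. F (a * fst p + b * snd p, c * fst p + d * snd p) \<partial>lborel)"
    using \<open>a \<noteq> 0\<close> by (intro nn_integral_cong arg_cong [where f = F]) (simp add: e_def field_simps)
  finally have "(\<integral>\<^sup>+p. F p \<partial>lborel) =
      ennreal (\<bar>a\<bar> * \<bar>e\<bar>) * (\<integral>\<^sup>+p. F (a * fst p + b * snd p, c * fst p + d * snd p) \<partial>lborel)"
    by (simp add: ennreal_mult mult.assoc)
  also have "\<bar>a\<bar> * \<bar>e\<bar> = \<bar>a * d - b * c\<bar>"
    using \<open>a \<noteq> 0\<close> by (simp add: e_def abs_divide)
  finally show ?thesis .
qed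

lemma distr_density_linear_2:
  fixes h :: "real \<times> real \<Rightarrow> ennreal"
  assumes h [measurable]: "h \<in> borel_measurable borel" and "a \<noteq> 0" "a * d - b * c \<noteq> 0"
  defines "g \<equiv> \<lambda>p. (a * fst p + b * snd p, c * fst p + d * snd p)"
  shows "distr (density lborel (\<lambda>p. ennreal \<bar>a * d - b * c\<bar> * h (g p))) borel g = density lborel h"
proof -
  have g [measurable]: "g \<in> borel_measurable borel"
    unfolding g_def by (intro borel_measurable_continuous_onI continuous_intros)
  have *: "distr lborel borel g = density lborel (\<lambda>_. ennreal (1 / \<bar>a * d - b * c\<bar>))"
  proof (rule measure_eqI)
    fix X assume "X \<in> sets (distr lborel borel g)"
    then have [measurable]: "X \<in> sets borel" by simp
    let ?D = "\<bar>a * d - b * c\<bar>"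
    have "emeasure lborel X = ennreal ?D * (\<integral>\<^sup>+p. indicator X (g p) \<partial>lborel)"
      using nn_integral_linear_2 [OF _ assms(2,3), of "indicator X"] by (simp add: g_def)
    also have "(\<integral>\<^sup>+p. indicator X (g p) \<partial>lborel) = emeasure (distr lborel borel g) X"
      by (simp add: nn_integral_distr flip: nn_integral_indicator)
    finally have "ennreal (1 / ?D) * emeasure lborel X =
        (ennreal (1 / ?D) * ennreal ?D) * emeasure (distr lborel borel g) X"
      by (simp only: mult.assoc)
    also have "ennreal (1 / ?D) * ennreal ?D = 1"
      using assms by (subst ennreal_mult [symmetric]) auto
    finally show "emeasure (distr lborel borel g) X =
        emeasure (density lborel (\<lambda>_. ennreal (1 / ?D))) X"
      by (simp add: emeasure_density nn_integral_cmult del: emeasure_distr)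
  qed simp
  have "distr (density lborel (\<lambda>p. ennreal \<bar>a * d - b * c\<bar> * h (g p))) borel g =
      density (distr lborel borel g) (\<lambda>p. ennreal \<bar>a * d - b * c\<bar> * h p)"
    by (rule density_distr [symmetric]) simp_all
  also have "\<dots> = density lborel (\<lambda>p. ennreal (1 / \<bar>a * d - b * c\<bar>) * (ennreal \<bar>a * d - b * c\<bar> * h p))"
    unfolding * by (rule density_density_eq) simp_all
  also have "\<dots> = density lborel h"
    using assms(3) by (simp add: mult.assoc [symmetric] flip: ennreal_mult)
  finally show ?thesis .
qed


section \<open>The Gaussian measures\<close>

abbreviation "mat_A \<equiv> mat2 1 0 0 2"
abbreviation "mat_B \<equiv> mat2 2 (- 1) (- 1) 1"

definition mu_density :: "real \<times> real \<Rightarrow> real" where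
  "mu_density p = sqrt 2 / (2 * pi) * exp (- ((fst p)\<^sup>2 + 2 * (snd p)\<^sup>2) / 2)"

text \<open>The exponent is the quadratic form of A + B, and the prefactor is that of
  \<open>mu_density\<close> times c0 = 2.\<close>

definition nu_density :: "real \<times> real \<Rightarrow> real" where
  "nu_density p =
    sqrt 2 / pi * exp (- (3 * (fst p)\<^sup>2 - 2 * fst p * snd p + 3 * (snd p)\<^sup>2) / 2)"

lemma mu_density_pos: "0 < mu_density p"
  by (simp add: mu_density_def)

lemma measurable_density_fun [measurable]:
  "mu_density \<in> borel_measurable borel" "nu_density \<in> borel_measurable borel"
  unfolding mu_density_def nu_density_def
  by (intro borel_measurable_continuous_onI continuous_intros; simp)+

lemma prob_space_mu_density: "prob_space (density lborel (\<lambda>p. ennreal (mu_density p)))"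
proof
  have nd: "(\<integral>\<^sup>+x. ennreal (normal_density 0 \<sigma> x) \<partial>lborel) = 1" if "0 < \<sigma>" for \<sigma>
    using prob_space.emeasure_space_1 [OF prob_space_normal_density [OF that, of 0]]
    by (simp add: emeasure_density)
  have split: "mu_density (x, y) = normal_density 0 1 x * normal_density 0 (1 / sqrt 2) y" for x y
  proof -
    have "normal_density 0 1 x * normal_density 0 (1 / sqrt 2) y =
        1 / (sqrt (2 * pi) * sqrt pi) * (exp (- (x\<^sup>2 / 2)) * exp (- y\<^sup>2))"
      by (simp add: normal_density_def power_divide)
    also have "sqrt (2 * pi) * sqrt pi = 2 * pi / sqrt 2"
      by (simp add: real_sqrt_mult real_div_sqrt field_simps)
    also have "exp (- (x\<^sup>2 / 2)) * exp (- y\<^sup>2) = exp (- (x\<^sup>2 + 2 * y\<^sup>2) / 2)"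
      by (simp add: field_simps flip: exp_add)
    finally show ?thesis by (simp add: mu_density_def)
  qed
  have "(\<integral>\<^sup>+p. ennreal (mu_density p) \<partial>(lborel \<Otimes>\<^sub>M lborel)) =
      (\<integral>\<^sup>+x. (\<integral>\<^sup>+y. ennreal (mu_density (x, y)) \<partial>lborel) \<partial>lborel)"
    by (rule lborel.nn_integral_fst [symmetric]) (simp add: lborel_prod)
  also have "\<dots> = (\<integral>\<^sup>+x. ennreal (normal_density 0 1 x) * (\<integral>\<^sup>+y. ennreal (normal_density 0 (1 / sqrt 2) y) \<partial>lborel) \<partial>lborel)"
    unfolding split by (simp add: ennreal_mult nn_integral_cmult)
  also have "\<dots> = 1" by (simp add: nd)
  finally show "emeasure (density lborel (\<lambda>p. ennreal (mu_density p)))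
      (space (density lborel (\<lambda>p. ennreal (mu_density p)))) = 1"
    by (simp add: emeasure_density lborel_prod)
qed

lemma mu_eq: "gaussian_vec 2 mat_A = distr (density lborel (\<lambda>p. ennreal (mu_density p))) (lborel_vec 2) vec2"
proof -
  let ?f = "\<lambda>x. ennreal (sqrt (Determinant.det mat_A) / (2 * pi) powr (real 2 / 2) *
      exp (- (1/2) * (x \<bullet> (mat_A *\<^sub>v x))))"
  have eq: "?f (vec2 p) = ennreal (mu_density p)" for p
    by (simp add: mu_density_def power2_eq_square algebra_simps)
  have "?f \<in> borel_measurable (lborel_vec 2)"
    by (rule measurable_lborel_vec_2I) (unfold eq, measurable)
  then have "density (distr lborel (lborel_vec 2) vec2) ?f = distr (density lborel (\<lambda>p. ?f (vec2 p))) (lborel_vec 2) vec2"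
    by (rule density_distr) simp
  then show ?thesis unfolding eq lborel_vec_2 [symmetric] by (simp add: gaussian_vec_def)
qed

lemma measurable_tilt: "gaussian_tilt c mat_B \<in> borel_measurable (lborel_vec 2)"
  by (rule measurable_lborel_vec_2I)
    (auto simp: gaussian_tilt_def intro!: borel_measurable_continuous_onI continuous_intros)

lemma nu_eq: "density (gaussian_vec 2 mat_A) (\<lambda>x. ennreal (gaussian_tilt 2 mat_B x)) =
    distr (density lborel (\<lambda>p. ennreal (nu_density p))) (lborel_vec 2) vec2"
proof -
  have prod: "ennreal (mu_density p) * ennreal (gaussian_tilt 2 mat_B (vec2 p)) = ennreal (nu_density p)" for p
    unfolding mu_density_def nu_density_def gaussian_tilt_def
    by (subst ennreal_mult [symmetric])
      (auto simp: power2_eq_square field_simps simp flip: exp_add)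
  have [measurable]: "(\<lambda>p. gaussian_tilt 2 mat_B (vec2 p)) \<in> borel_measurable borel"
    using measurable_compose [OF measurable_vec2 measurable_tilt] .
  have "density (gaussian_vec 2 mat_A) (\<lambda>x. ennreal (gaussian_tilt 2 mat_B x)) =
      distr (density (density lborel (\<lambda>p. ennreal (mu_density p)))
        (\<lambda>p. ennreal (gaussian_tilt 2 mat_B (vec2 p)))) (lborel_vec 2) vec2"
    unfolding mu_eq
    by (rule density_distr) (auto intro!: measurable_compose [OF measurable_tilt])
  also have "density (density lborel (\<lambda>p. ennreal (mu_density p)))
        (\<lambda>p. ennreal (gaussian_tilt 2 mat_B (vec2 p))) = density lborel (\<lambda>p. ennreal (nu_density p))"
    by (subst density_density_eq) (simp_all add: prod)
  finally show ?thesis .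
qed

lemma prob_space_mu: "prob_space (gaussian_vec 2 mat_A)"
  unfolding mu_eq by (intro prob_space.prob_space_distr prob_space_mu_density) simp

text \<open>The Gaussian density vanishes nowhere, so its null sets are Lebesgue null sets.\<close>

lemma AE_mu_imp_AE_lborel:
  assumes "AE v in gaussian_vec 2 mat_A. P v"
  shows "AE p in lborel. P (vec2 p)"
proof -
  have "AE p in density lborel (\<lambda>p. ennreal (mu_density p)). P (vec2 p)"
    using assms unfolding mu_eq by (rule AE_distrD [rotated]) simp
  then show ?thesis
    by (subst (asm) AE_density) (auto simp: mu_density_pos)
qed


section \<open>Gradients of quadratic functions\<close>

text \<open>\<open>gradient_vec\<close> is a definite description; uniqueness is what lets a
  computed gradient be identified with it.\<close>

lemma has_gradient_vec2_unique:
  assumes "has_gradient_vec 2 f g x" "has_gradient_vec 2 f g' x"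
  shows "g = g'"
proof (rule ccontr)
  assume "g \<noteq> g'"
  obtain G G' X where eqs: "g = vec2 G" "g' = vec2 G'" "x = vec2 X"
    using assms unfolding has_gradient_vec_def by (metis carrier_vec_2_cases)
  define D where "D = G - G'"
  have "D \<noteq> 0" using \<open>g \<noteq> g'\<close> by (simp add: D_def eqs)
  \<comment> \<open>With tolerance |D| / 4 the two errors add up to at most half of what a step in
    direction D makes the two linear parts differ by.\<close>
  then have "norm D / 4 > 0" by simp
  with assms obtain \<delta> \<delta>' where "\<delta> > 0" "\<delta>' > 0"
    and \<delta>: "\<And>y. norm (y - X) < \<delta> \<Longrightarrow>
      \<bar>f (vec2 y) - f (vec2 X) - vec2 G \<bullet> vec2 (y - X)\<bar> \<le> norm D / 4 * norm (y - X)"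
    and \<delta>': "\<And>y. norm (y - X) < \<delta>' \<Longrightarrow>
      \<bar>f (vec2 y) - f (vec2 X) - vec2 G' \<bullet> vec2 (y - X)\<bar> \<le> norm D / 4 * norm (y - X)"
    unfolding has_gradient_vec_def ball_carrier_vec_2 eqs vec2_arith vec_norm2_vec2 by metis
  define s where "s = min \<delta> \<delta>' / (2 * norm D)"
  have "s > 0" using \<open>\<delta> > 0\<close> \<open>\<delta>' > 0\<close> \<open>D \<noteq> 0\<close> by (simp add: s_def)
  define y where "y = X + s *\<^sub>R D"
  have ny: "norm (y - X) = s * norm D" using \<open>s > 0\<close> by (simp add: y_def)
  also have "\<dots> = min \<delta> \<delta>' / 2" using \<open>D \<noteq> 0\<close> by (simp add: s_def)
  finally have "norm (y - X) < \<delta>" "norm (y - X) < \<delta>'" using \<open>\<delta> > 0\<close> \<open>\<delta>' > 0\<close> by auto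
  from \<delta> [OF this(1)] \<delta>' [OF this(2)]
  have "\<bar>vec2 G \<bullet> vec2 (y - X) - vec2 G' \<bullet> vec2 (y - X)\<bar> \<le> norm D / 2 * norm (y - X)"
    by linarith
  moreover have "vec2 G \<bullet> vec2 (y - X) - vec2 G' \<bullet> vec2 (y - X) = s * (norm D)\<^sup>2"
    by (cases D, cases G, cases G') (simp add: y_def D_def norm_Pair power2_eq_square algebra_simps)
  ultimately have "s * (norm D)\<^sup>2 \<le> s * (norm D)\<^sup>2 / 2"
    using \<open>s > 0\<close> by (simp add: ny power2_eq_square)
  with \<open>s > 0\<close> \<open>D \<noteq> 0\<close> show False by (simp add: mult_le_0_iff)
qed

lemma has_gradient_quadratic:
  assumes f: "\<And>p. f (vec2 p) = k + (a * (fst p)\<^sup>2 + 2 * b * fst p * snd p + d * (snd p)\<^sup>2) / 2"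
  shows "has_gradient_vec 2 f (vec2 (a * fst p + b * snd p, b * fst p + d * snd p)) (vec2 p)"
  unfolding has_gradient_vec_def ball_carrier_vec_2 vec2_arith vec_norm2_vec2
proof (intro conjI allI impI)
  fix \<epsilon> :: real assume "\<epsilon> > 0"
  define K where "K = \<bar>a\<bar> + \<bar>b\<bar> + \<bar>d\<bar> + 1"
  have "K > 0" by (simp add: K_def)
  show "\<exists>\<delta>>0. \<forall>q. norm (q - p) < \<delta> \<longrightarrow>
      \<bar>f (vec2 q) - f (vec2 p) - vec2 (a * fst p + b * snd p, b * fst p + d * snd p) \<bullet> vec2 (q - p)\<bar>
        \<le> \<epsilon> * norm (q - p)"
  proof (intro exI conjI allI impI)
    show "\<epsilon> / K > 0" using \<open>\<epsilon> > 0\<close> \<open>K > 0\<close> by simp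
    fix q assume q: "norm (q - p) < \<epsilon> / K"
    obtain u v where uv: "q - p = (u, v)" by (cases "q - p")
    have "f (vec2 q) - f (vec2 p) - vec2 (a * fst p + b * snd p, b * fst p + d * snd p) \<bullet> vec2 (q - p) =
        (a * u\<^sup>2 + 2 * b * u * v + d * v\<^sup>2) / 2"
      using uv unfolding f by (cases p, cases q) (auto simp: power2_eq_square algebra_simps add_divide_distrib diff_divide_distrib)
    also have "\<bar>\<dots>\<bar> \<le> K * (norm (q - p))\<^sup>2"
    proof -
      have "\<bar>a * u\<^sup>2\<bar> \<le> \<bar>a\<bar> * (u\<^sup>2 + v\<^sup>2)" "\<bar>d * v\<^sup>2\<bar> \<le> \<bar>d\<bar> * (u\<^sup>2 + v\<^sup>2)"
        by (auto simp: abs_mult intro!: mult_left_mono)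
      moreover have "\<bar>b * (2 * u * v)\<bar> \<le> \<bar>b\<bar> * (u\<^sup>2 + v\<^sup>2)"
        unfolding abs_mult [of b]
        using sum_squares_bound [of u v] sum_squares_bound [of u "- v"]
        by (intro mult_left_mono) (auto simp: abs_le_iff)
      ultimately have 1: "\<bar>a * u\<^sup>2 + 2 * b * u * v + d * v\<^sup>2\<bar> \<le> (\<bar>a\<bar> + \<bar>b\<bar> + \<bar>d\<bar>) * (u\<^sup>2 + v\<^sup>2)"
        by (simp add: algebra_simps abs_le_iff)
      have 2: "\<bar>(a * u\<^sup>2 + 2 * b * u * v + d * v\<^sup>2) / 2\<bar> \<le> \<bar>a * u\<^sup>2 + 2 * b * u * v + d * v\<^sup>2\<bar>"
        by simp
      have 3: "(\<bar>a\<bar> + \<bar>b\<bar> + \<bar>d\<bar>) * (u\<^sup>2 + v\<^sup>2) \<le> K * (u\<^sup>2 + v\<^sup>2)"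
        by (intro mult_right_mono) (auto simp: K_def)
      have 4: "(norm (q - p))\<^sup>2 = u\<^sup>2 + v\<^sup>2"
        unfolding uv by (simp add: norm_Pair)
      show ?thesis unfolding 4 using 2 1 3 by (rule order_trans [OF order_trans])
    qed
    also have "\<dots> = (K * norm (q - p)) * norm (q - p)" by (simp add: power2_eq_square)
    also have "\<dots> \<le> \<epsilon> * norm (q - p)"
      using q \<open>K > 0\<close> by (intro mult_right_mono) (auto simp: field_simps)
    finally show "\<bar>f (vec2 q) - f (vec2 p) -
        vec2 (a * fst p + b * snd p, b * fst p + d * snd p) \<bullet> vec2 (q - p)\<bar> \<le> \<epsilon> * norm (q - p)" .
  qed
qed auto

lemma gradient_quadratic:
  assumes "\<And>p. f (vec2 p) = k + (a * (fst p)\<^sup>2 + 2 * b * fst p * snd p + d * (snd p)\<^sup>2) / 2"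
  shows "gradient_vec 2 f (vec2 p) = vec2 (a * fst p + b * snd p, b * fst p + d * snd p)"
  unfolding gradient_vec_def
  using has_gradient_quadratic [of f, OF assms] has_gradient_vec2_unique by (blast intro: the_equality)


section \<open>The Brenier map\<close>

text \<open>The symmetric positive definite solution \<open>G\<close> of \<open>G A\<inverse> G = (A + B)\<inverse>\<close>.\<close>

lemma brenier_map_exists:
  "is_brenier_map 2 (gaussian_vec 2 mat_A)
     (density (gaussian_vec 2 mat_A) (\<lambda>x. ennreal (gaussian_tilt 2 mat_B x)))
     (\<lambda>v. mat2 (5 / (2 * sqrt 17)) (1 / (2 * sqrt 17)) (1 / (2 * sqrt 17)) (7 / (2 * sqrt 17)) *\<^sub>v v)"
    (is "is_brenier_map 2 ?\<mu> ?\<nu> ?G")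
proof -
  \<comment> \<open>For X = \<open>A^(-1/2) G A^(-1/2)\<close>, Cayley-Hamilton makes G proportional
    to (A + B)^(-1) + (det G / det A) A. The equation forces det G = 1/2, so this is [[5, 1],
    [1, 7]] / 8; rescaling to 34 k^2 = 1/2 gives k.\<close>
  define k :: real where "k = 1 / (2 * sqrt 17)"
  have k: "k > 0" "k\<^sup>2 = 1 / 68" by (simp_all add: k_def power_divide power_mult_distrib)
  let ?g = "\<lambda>p. ((5 * k) * fst p + k * snd p, k * fst p + (7 * k) * snd p)"
  have G: "?G (vec2 p) = vec2 (?g p)" for p by (simp add: k_def)
  have g [measurable]: "?g \<in> borel_measurable borel"
    by (intro borel_measurable_continuous_onI continuous_intros)
  have measG: "?G \<in> measurable (lborel_vec 2) (lborel_vec 2)"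
    by (rule measurable_lborel_vec_2I) (unfold G, rule measurable_compose [OF g measurable_vec2])
  define \<phi> where "\<phi> v = v \<bullet> ?G v / 2" for v
  have \<phi>: "\<phi> (vec2 p) = 0 + ((5 * k) * (fst p)\<^sup>2 + 2 * k * fst p * snd p + (7 * k) * (snd p)\<^sup>2) / 2" for p
    unfolding \<phi>_def G by (simp add: power2_eq_square algebra_simps)
  have convex: "convex_fun_vec 2 \<phi>"
    unfolding convex_fun_vec_def ball_carrier_vec_2 vec2_arith
  proof (intro allI ballI)
    fix p q :: "real \<times> real" and t :: real assume t: "t \<in> {0..1}"
    obtain x y u v where pq: "p = (x, y)" "q = (u, v)" by fastforce
    \<comment> \<open>The convexity gap of a quadratic form is t (1 - t) / 2 times the form 5 X^2 +
      2 X Y + 7 Y^2 (up to k) of the difference, written here as a sum of squares.\<close>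
    have "(1 - t) * \<phi> (vec2 p) + t * \<phi> (vec2 q) - \<phi> (vec2 ((1 - t) *\<^sub>R p + t *\<^sub>R q)) =
        t * (1 - t) * (k / 2) * (4 * (x - u)\<^sup>2 + ((x - u) + (y - v))\<^sup>2 + 6 * (y - v)\<^sup>2)"
      unfolding \<phi> pq by (simp add: power2_eq_square field_simps)
    also have "\<dots> \<ge> 0" using t k by (intro mult_nonneg_nonneg add_nonneg_nonneg) auto
    finally show "\<phi> (vec2 ((1 - t) *\<^sub>R p + t *\<^sub>R q)) \<le> (1 - t) * \<phi> (vec2 p) + t * \<phi> (vec2 q)" by simp
  qed
  have grad: "has_gradient_vec 2 \<phi> (?G v) v" if v: "v \<in> carrier_vec 2" for v
    using v has_gradient_quadratic [of \<phi>, OF \<phi>] unfolding G [symmetric]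
    by (metis carrier_vec_2_cases)
  have det: "(5 * k) * (7 * k) - k * k = 1 / 2"
    using k(2) by (simp add: power2_eq_square)
  have "ennreal (mu_density p) = ennreal \<bar>(5 * k) * (7 * k) - k * k\<bar> * ennreal (nu_density (?g p))" for p
  proof -
    obtain x y where p: "p = (x, y)" by (cases p)
    have "3 * (5 * k * x + k * y)\<^sup>2 - 2 * (5 * k * x + k * y) * (k * x + 7 * k * y) + 3 * (k * x + 7 * k * y)\<^sup>2
        = k\<^sup>2 * (68 * (x\<^sup>2 + 2 * y\<^sup>2))"
      by (simp add: power2_eq_square algebra_simps)
    also have "\<dots> = x\<^sup>2 + 2 * y\<^sup>2" by (simp add: k(2))
    finally have "nu_density (?g p) = 2 * mu_density p"
      unfolding p nu_density_def mu_density_def by simp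
    then show ?thesis 
      unfolding det using mu_density_pos [of p] by (subst ennreal_mult [symmetric]) auto
  qed
  then have "distr (density lborel (\<lambda>p. ennreal (mu_density p))) borel ?g =
      density lborel (\<lambda>p. ennreal (nu_density p))"
    using distr_density_linear_2 [of "\<lambda>p. ennreal (nu_density p)" "5 * k" "7 * k" k k] k det
    by simp
  then have "?\<nu> = distr (distr (density lborel (\<lambda>p. ennreal (mu_density p))) borel ?g) (lborel_vec 2) vec2"
    unfolding nu_eq by simp
  also have "\<dots> = distr (density lborel (\<lambda>p. ennreal (mu_density p))) (lborel_vec 2) (?G \<circ> vec2)"
    by (subst distr_distr) (auto simp: o_def G [symmetric])
  also have "\<dots> = distr ?\<mu> (lborel_vec 2) ?G"
    unfolding mu_eq by (subst distr_distr) (auto intro: measG)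
  finally have push: "distr ?\<mu> (lborel_vec 2) ?G = ?\<nu>" by simp
  have space: "space ?\<mu> = carrier_vec 2" unfolding mu_eq by simp
  have "AE x in ?\<mu>. has_gradient_vec 2 \<phi> (?G x) x"
    by (rule AE_I2) (simp only: space grad)
  with measG convex push show ?thesis unfolding is_brenier_map_def by blast
qed

text \<open>The mass of \<nu> is inherited from \<mu> through the push-forward just established,
  which confirms the constant c0 = 2.\<close>

lemma prob_space_nu: "prob_space (density (gaussian_vec 2 mat_A) (\<lambda>x. ennreal (gaussian_tilt 2 mat_B x)))"
proof -
  obtain G where G: "G \<in> measurable (lborel_vec 2) (lborel_vec 2)"
    and push: "distr (gaussian_vec 2 mat_A) (lborel_vec 2) G =
      density (gaussian_vec 2 mat_A) (\<lambda>x. ennreal (gaussian_tilt 2 mat_B x))"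
    using brenier_map_exists unfolding is_brenier_map_def by blast
  have "sets (gaussian_vec 2 mat_A) = sets (lborel_vec 2)" unfolding mu_eq by simp
  then have "G \<in> measurable (gaussian_vec 2 mat_A) (lborel_vec 2)"
    using G by (simp cong: measurable_cong_sets)
  then show ?thesis
    unfolding push [symmetric] by (rule prob_space.prob_space_distr [OF prob_space_mu])
qed


section \<open>Linear gradients of convex functions\<close>

text \<open>The complement is open and Lebesgue null, and a nonempty open set has positive
  measure.\<close>

lemma closed_AE_lborel_imp_all:
  fixes P :: "'a::euclidean_space \<Rightarrow> bool"
  assumes "closed {x. P x}" "AE x in lborel. P x"
  shows "P x"
proof (rule ccontr)
  assume "\<not> P x"
  define S where "S = - {x. P x}"
  have "open S" unfolding S_def using assms(1) by (rule open_Compl)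
  then have "S \<in> sets lborel" by simp
  moreover have "AE x in lborel. x \<notin> S" using assms(2) by (simp add: S_def)
  ultimately have "S \<in> null_sets lborel" by (simp add: AE_iff_null_sets)
  then have "negligible S"
    by (simp add: negligible_iff_null_sets null_sets_completionI)
  with \<open>open S\<close> \<open>\<not> P x\<close> show False
    using open_not_negligible [of S] by (auto simp: S_def)
qed

lemma convex_fun_vec2D:
  assumes "convex_fun_vec 2 \<phi>" "0 \<le> t" "t \<le> 1"
  shows "\<phi> (vec2 ((1 - t) *\<^sub>R p + t *\<^sub>R q)) \<le> (1 - t) * \<phi> (vec2 p) + t * \<phi> (vec2 q)"
  using assms(1) [unfolded convex_fun_vec_def, THEN bspec, of "vec2 p", THEN bspec, of "vec2 q",
      THEN bspec, of t] assms(2,3)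
  by simp

lemma convex_fun_vec2_continuous:
  assumes "convex_fun_vec 2 \<phi>"
  shows "continuous_on UNIV (\<lambda>p. \<phi> (vec2 p))"
proof (rule convex_on_continuous)
  show "convex_on UNIV (\<lambda>p. \<phi> (vec2 p))"
  proof (rule convex_onI)
    fix t :: real and x y :: "real \<times> real" assume "0 < t" "t < 1"
    then show "\<phi> (vec2 ((1 - t) *\<^sub>R x + t *\<^sub>R y)) \<le> (1 - t) * \<phi> (vec2 x) + t * \<phi> (vec2 y)"
      using assms by (intro convex_fun_vec2D) auto
  qed auto
qed auto

text \<open>Differentiability gives the inequality near p up to a small multiple of the distance;
  convexity along the segment carries it to q, since all terms scale with the same t.\<close>

lemma convex_gradient_ineq:
  assumes conv: "convex_fun_vec 2 \<phi>" and grad: "has_gradient_vec 2 \<phi> (vec2 g) (vec2 p)"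
  shows "inner g (q - p) \<le> \<phi> (vec2 q) - \<phi> (vec2 p)"
proof (cases "q = p")
  case False
  show ?thesis
  proof (rule field_le_epsilon)
    fix e :: real assume "e > 0"
    define n where "n = norm (q - p)"
    have "n > 0" using False by (simp add: n_def)
    obtain \<delta> where "\<delta> > 0" and \<delta>: "\<And>y. norm (y - p) < \<delta> \<Longrightarrow>
        \<bar>\<phi> (vec2 y) - \<phi> (vec2 p) - vec2 g \<bullet> vec2 (y - p)\<bar> \<le> e / n * norm (y - p)"
      using grad \<open>e > 0\<close> \<open>n > 0\<close>
      unfolding has_gradient_vec_def ball_carrier_vec_2 vec2_arith vec_norm2_vec2
      by (metis divide_pos_pos)
    \<comment> \<open>The 1 keeps y on the segment, the other bound keeps it in the neighbourhood
      where the expansion holds.\<close>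
    define t where "t = min 1 (\<delta> / (2 * n))"
    have t: "0 < t" "t \<le> 1" using \<open>\<delta> > 0\<close> \<open>n > 0\<close> by (auto simp: t_def)
    have "t * n \<le> \<delta> / 2" using \<open>n > 0\<close> by (auto simp: t_def min_def field_simps)
    then have tn: "t * n < \<delta>" using \<open>\<delta> > 0\<close> by simp
    define y where "y = (1 - t) *\<^sub>R p + t *\<^sub>R q"
    have y: "y - p = t *\<^sub>R (q - p)" by (simp add: y_def algebra_simps)
    then have ny: "norm (y - p) = t * n" using t by (simp add: n_def)
    have "vec2 g \<bullet> vec2 (y - p) = t * inner g (q - p)"
      unfolding y by (cases g, cases "q - p") (simp add: algebra_simps)
    then have "t * inner g (q - p) - \<phi> (vec2 y) + \<phi> (vec2 p) \<le> e / n * (t * n)"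
      using \<delta> [of y] ny tn by (simp add: abs_le_iff)
    moreover have "\<phi> (vec2 y) \<le> (1 - t) * \<phi> (vec2 p) + t * \<phi> (vec2 q)"
      using conv t unfolding y_def by (intro convex_fun_vec2D) auto
    ultimately have "t * inner g (q - p) \<le> t * (\<phi> (vec2 q) - \<phi> (vec2 p) + e)"
      using \<open>n > 0\<close> by (simp add: algebra_simps)
    then show "inner g (q - p) \<le> \<phi> (vec2 q) - \<phi> (vec2 p) + e"
      using t by simp
  qed
qed simp

text \<open>The subgradient inequality, applied along a fine subdivision of the segment from \<open>p\<close> to
  \<open>p + v\<close>, recovers in the limit the line integral of the gradient.\<close>

lemma linear_subgradient_integral:
  fixes f :: "'a::euclidean_space \<Rightarrow> real"
  assumes "linear L" and sub: "\<And>p q. inner (L p) (q - p) \<le> f q - f p"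
  shows "inner (L p) v + inner (L v) v / 2 \<le> f (p + v) - f p"
proof -
  define s where "s = inner (L v) v"
  \<comment> \<open>The subgradient is taken at the left end of each piece, so the sum runs over 0,
    ..., k - 1. This gives k (k - 1) / 2 and, for k = N, a defect of order 1 / N.\<close>
  have step: "real k / N * inner (L p) v + s * (real k * (real k - 1) / (2 * N\<^sup>2))
      \<le> f (p + (real k / N) *\<^sub>R v) - f p" if "N > 0" for N :: real and k :: nat
  proof (induction k)
    case (Suc k)
    have diff: "(p + (real (Suc k) / N) *\<^sub>R v) - (p + (real k / N) *\<^sub>R v) = (1 / N) *\<^sub>R v"
      by (simp add: scaleR_left_diff_distrib [symmetric] diff_divide_distrib [symmetric])
    have "L (p + (real k / N) *\<^sub>R v) = L p + (real k / N) *\<^sub>R L v"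
      using \<open>linear L\<close> by (simp add: linear_add linear_scale)
    then have "1 / N * (inner (L p) v + real k / N * s)
        \<le> f (p + (real (Suc k) / N) *\<^sub>R v) - f (p + (real k / N) *\<^sub>R v)"
      using sub [of "p + (real k / N) *\<^sub>R v" "p + (real (Suc k) / N) *\<^sub>R v"]
      unfolding diff by (simp add: inner_add_left s_def)
    moreover have "real (Suc k) / N * inner (L p) v + s * (real (Suc k) * (real (Suc k) - 1) / (2 * N\<^sup>2)) =
        1 / N * (inner (L p) v + real k / N * s) +
        (real k / N * inner (L p) v + s * (real k * (real k - 1) / (2 * N\<^sup>2)))"
      using \<open>N > 0\<close> by (simp add: field_simps power2_eq_square)
    ultimately show ?case using Suc by linarith
  qed simp
  have le: "inner (L p) v + s * (1 / 2 - 1 / (2 * real (Suc n))) \<le> f (p + v) - f p" for n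
  proof -
    have "N * (N - 1) / (2 * N\<^sup>2) = 1 / 2 - 1 / (2 * N)" if "N > 0" for N :: real
      using that by (simp add: field_simps power2_eq_square)
    from this [of "real (Suc n)"] show ?thesis using step [of "real (Suc n)" "Suc n"] by simp
  qed
  have "(\<lambda>n. 1 / 2 * (1 / real (Suc n))) \<longlonglongrightarrow> 1 / 2 * 0"
    by (intro tendsto_mult tendsto_const lim_1_over_n [THEN LIMSEQ_Suc])
  then have "(\<lambda>n. inner (L p) v + s * (1 / 2 - 1 / (2 * real (Suc n)))) \<longlonglongrightarrow> inner (L p) v + s * (1 / 2 - 0)"
    by (intro tendsto_intros) simp
  then have "inner (L p) v + s * (1 / 2 - 0) \<le> f (p + v) - f p"
    by (rule LIMSEQ_le_const2) (use le in auto)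
  then show ?thesis by (simp add: s_def)
qed

text \<open>A gradient field has zero circulation. Around the triangle 0, (1, 0), (0, 1) the
  circulation of the linear field is (c - b) / 2.\<close>

lemma convex_gradient_linear_imp_symmetric:
  assumes conv: "convex_fun_vec 2 \<phi>"
    and grad: "AE p in lborel.
      has_gradient_vec 2 \<phi> (vec2 (a * fst p + b * snd p, c * fst p + d * snd p)) (vec2 p)"
  shows "b = c"
proof -
  define L where "L p = (a * fst p + b * snd p, c * fst p + d * snd p)" for p :: "real \<times> real"
  define f where "f p = \<phi> (vec2 p)" for p
  have "linear L" by (rule linearI) (auto simp: L_def algebra_simps)
  have contf: "continuous_on UNIV f"
    unfolding f_def using conv by (rule convex_fun_vec2_continuous)
  have contL: "continuous_on UNIV L" unfolding L_def by (intro continuous_intros)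
  \<comment> \<open>For fixed q both sides are continuous in p, so the inequality passes from almost
    every p to every p. This matters because the triangle itself is a null set.\<close>
  have sub: "inner (L p) (q - p) \<le> f q - f p" for p q
  proof (rule closed_AE_lborel_imp_all [where x = p])
    show "closed {p. inner (L p) (q - p) \<le> f q - f p}"
      by (intro closed_Collect_le continuous_intros contf contL)
    show "AE p in lborel. inner (L p) (q - p) \<le> f q - f p"
      using grad by eventually_elim (auto simp: f_def L_def intro: convex_gradient_ineq [OF conv])
  qed
  note int = linear_subgradient_integral [OF \<open>linear L\<close> sub]
  \<comment> \<open>Traversing a leg in both directions turns the one-sided bound into an
    equality.\<close>
  have "f (1, 0) - f 0 = a / 2" "f (0, 1) - f 0 = d / 2"
    using int [of 0 "(1, 0)"] int [of "(1, 0)" "(- 1, 0)"] int [of 0 "(0, 1)"] int [of "(0, 1)" "(0, - 1)"]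
    by (simp_all add: L_def zero_prod_def)
  moreover have "c - a + (a - b + (d - c)) / 2 \<le> f (0, 1) - f (1, 0)"
    using int [of "(1, 0)" "(- 1, 1)"] by (simp add: L_def)
  moreover have "b - d + (a - b + (d - c)) / 2 \<le> f (1, 0) - f (0, 1)"
    using int [of "(0, 1)" "(1, - 1)"] by (simp add: L_def algebra_simps)
  ultimately have "c \<le> b" "b \<le> c" by argo+
  then show ?thesis by simp
qed


section \<open>Planar linear systems\<close>

text \<open>If \<open>C' = M C + C M\<close> then every factorization \<open>C = L L\<^sup>T\<close> yields solutions \<open>L R w\<close> of
  \<open>y' = M y\<close>, with \<open>R\<close> a rotation whose angle is obtained by quadrature. Below, \<open>L\<close> is the
  Cholesky factor of \<open>C\<close>, with entries \<open>\<alpha>\<close>, \<open>c / \<alpha>\<close> and \<open>\<eta> / \<alpha>\<close>, so that \<open>\<eta>\<^sup>2 = det C\<close>.\<close>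

lemma cholesky_rotation_derivatives:
  fixes \<alpha> \<eta> c \<theta> :: "real \<Rightarrow> real"
  assumes "\<alpha> t > 0"
    and \<alpha>: "(\<alpha> has_real_derivative m11 * \<alpha> t + m12 * c t / \<alpha> t) (at t within S)"
    and \<eta>: "(\<eta> has_real_derivative (m11 + m22) * \<eta> t) (at t within S)"
    and c: "(c has_real_derivative (m11 + m22) * c t + m12 * (((\<eta> t)\<^sup>2 + (c t)\<^sup>2) / (\<alpha> t)\<^sup>2 + (\<alpha> t)\<^sup>2))
      (at t within S)"
    and \<theta>: "(\<theta> has_real_derivative - m12 * \<eta> t / (\<alpha> t)\<^sup>2) (at t within S)"
  defines "u \<equiv> \<lambda>t. \<alpha> t * cos (\<theta> t)" and "v \<equiv> \<lambda>t. (c t * cos (\<theta> t) + \<eta> t * sin (\<theta> t)) / \<alpha> t"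
  shows "(u has_real_derivative m11 * u t + m12 * v t) (at t within S)"
    and "(v has_real_derivative m12 * u t + m22 * v t) (at t within S)"
proof -
  show "(u has_real_derivative m11 * u t + m12 * v t) (at t within S)"
    unfolding u_def v_def using \<open>\<alpha> t > 0\<close>
    by (auto intro!: derivative_eq_intros \<alpha> \<theta> simp: field_simps power2_eq_square)
  show "(v has_real_derivative m12 * u t + m22 * v t) (at t within S)"
    unfolding u_def v_def using \<open>\<alpha> t > 0\<close>
    by (auto intro!: derivative_eq_intros \<alpha> \<theta> \<eta> c simp: field_simps power2_eq_square)
qed

lemma DERIV_of_within_Ici:
  "(f has_real_derivative D) (at t within {0..}) \<Longrightarrow> t > 0 \<Longrightarrow> (f has_real_derivative D) (at t)"
  using at_within_open [of t "{0<..}"] has_field_derivative_subset [of f D t "{0..}" "{0<..}"]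
  by (simp add: subset_eq)

lemma nondecreasing_on_Ici:
  fixes f D :: "real \<Rightarrow> real"
  assumes "\<And>t. t \<ge> 0 \<Longrightarrow> (f has_real_derivative D t) (at t within {0..})"
    and "\<And>t. t > 0 \<Longrightarrow> 0 \<le> D t" and "0 \<le> a" "a \<le> b"
  shows "f a \<le> f b"
proof (rule DERIV_nonneg_imp_increasing_open [OF \<open>a \<le> b\<close>])
  show "\<exists>y. (f has_real_derivative y) (at t) \<and> 0 \<le> y" if "a < t" for t
    using assms that DERIV_of_within_Ici [of f "D t" t] by force
  have "continuous_on {0..} f" by (rule DERIV_continuous_on) (use assms in auto)
  then show "continuous_on {a..b} f"
    by (rule continuous_on_subset) (use \<open>0 \<le> a\<close> in auto)
qed

text \<open>The sign is demanded only for t > 0: some derivatives to which this is applied vanish at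
  the initial time.\<close>

lemma increasing_on_Ici:
  fixes f D :: "real \<Rightarrow> real"
  assumes "\<And>t. t \<ge> 0 \<Longrightarrow> (f has_real_derivative D t) (at t within {0..})"
    and "\<And>t. t > 0 \<Longrightarrow> 0 < D t" and "0 \<le> a" "a < b"
  shows "f a < f b"
proof (rule DERIV_pos_imp_increasing_open [OF \<open>a < b\<close>])
  show "\<exists>y. (f has_real_derivative y) (at t) \<and> 0 < y" if "a < t" for t
    using assms that DERIV_of_within_Ici [of f "D t" t] by force
  have "continuous_on {0..} f" by (rule DERIV_continuous_on) (use assms in auto)
  then show "continuous_on {a..b} f"
    by (rule continuous_on_subset) (use \<open>0 \<le> a\<close> in auto)
qed

text \<open>The energy of the negative parts satisfies \<open>F' \<le> C F\<close>, as the off-diagonal entries are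
  nonnegative.\<close>

lemma cooperative_linear_nonneg:
  fixes y :: "'i \<Rightarrow> real \<Rightarrow> real" and N :: "'i \<Rightarrow> 'i \<Rightarrow> real \<Rightarrow> real"
  assumes "finite I"
    and der: "\<And>i t. i \<in> I \<Longrightarrow> t \<ge> 0 \<Longrightarrow>
      (y i has_real_derivative (\<Sum>j\<in>I. N i j t * y j t)) (at t within {0..})"
    and N: "\<And>i j t. i \<in> I \<Longrightarrow> j \<in> I \<Longrightarrow> t \<ge> 0 \<Longrightarrow> 0 \<le> N i j t \<and> N i j t \<le> C"
    and init: "\<And>i. i \<in> I \<Longrightarrow> 0 \<le> y i 0"
    and "k \<in> I" "T \<ge> 0"
  shows "0 \<le> y k T"
proof -
  \<comment> \<open>The negative part itself has a kink at 0, but its square is differentiable with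
    derivative 2 n z.\<close>
  define n where "n z = min z (0::real)" for z
  define F where "F t = (\<Sum>i\<in>I. (n (y i t))\<^sup>2)" for t
  define K where "K = 2 * (real (card I) * C)"
  have n2: "((\<lambda>z. (n z)\<^sup>2) has_real_derivative 2 * n z) (at z)" for z
  proof -
    have quad: "\<bar>(n (z + h))\<^sup>2 - (n z)\<^sup>2 - 2 * n z * h\<bar> \<le> h\<^sup>2" for h
    proof -
      have "0 \<le> (z + h)\<^sup>2" by simp
      moreover have "0 \<le> - z * (z + 2 * h)" if "z \<le> 0" "z + h > 0"
        using that by (intro mult_nonneg_nonneg) auto
      moreover have "0 \<le> z * (- (z + 2 * h))" if "z > 0" "z + h \<le> 0"
        using that by (intro mult_nonneg_nonneg) auto
      ultimately show ?thesis
        by (auto simp: n_def min_def power2_eq_square abs_le_iff algebra_simps)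
    qed
    have "\<forall>\<^sub>F h in at 0. norm (((n (z + h))\<^sup>2 - (n z)\<^sup>2) / h - 2 * n z) \<le> norm h"
    proof (rule eventually_at_filter [THEN iffD2], rule always_eventually, intro allI impI)
      fix h :: real assume "h \<noteq> 0"
      then have "((n (z + h))\<^sup>2 - (n z)\<^sup>2) / h - 2 * n z = ((n (z + h))\<^sup>2 - (n z)\<^sup>2 - 2 * n z * h) / h"
        by (simp add: field_simps)
      then have "norm (((n (z + h))\<^sup>2 - (n z)\<^sup>2) / h - 2 * n z) \<le> h\<^sup>2 / \<bar>h\<bar>"
        using divide_right_mono [OF quad [of h], of "\<bar>h\<bar>"] by (simp add: abs_divide)
      also have "h\<^sup>2 / \<bar>h\<bar> = norm h" using \<open>h \<noteq> 0\<close> by (simp add: power2_eq_square abs_if)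
      finally show "norm (((n (z + h))\<^sup>2 - (n z)\<^sup>2) / h - 2 * n z) \<le> norm h" .
    qed
    then have "((\<lambda>h. ((n (z + h))\<^sup>2 - (n z)\<^sup>2) / h - 2 * n z) \<longlongrightarrow> 0) (at 0)"
      by (rule Lim_null_comparison) (auto intro!: tendsto_eq_intros)
    then show ?thesis by (simp add: DERIV_def LIM_zero_iff)
  qed
  have derF: "(F has_real_derivative (\<Sum>i\<in>I. 2 * n (y i t) * (\<Sum>j\<in>I. N i j t * y j t))) (at t within {0..})"
    if "t \<ge> 0" for t
    unfolding F_def
    using that by (intro DERIV_sum DERIV_chain2 [OF n2] der)
  have le: "(\<Sum>i\<in>I. 2 * n (y i t) * (\<Sum>j\<in>I. N i j t * y j t)) \<le> K * F t" if "t \<ge> 0" for t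
  proof -
    have 1: "2 * n (y i t) * (N i j t * y j t) \<le> C * ((n (y i t))\<^sup>2 + (n (y j t))\<^sup>2)"
      if "i \<in> I" "j \<in> I" for i j
    proof -
      \<comment> \<open>Since y \<ge> n y and n y \<le> 0, replacing y by n y in the second factor
        can only increase the product; this is why positive parts do no harm when the coefficients
        are nonnegative.\<close>
      have "n (y i t) * y j t \<le> n (y i t) * n (y j t)"
        by (intro mult_left_mono_neg) (auto simp: n_def)
      also have "2 * (n (y i t) * n (y j t)) \<le> (n (y i t))\<^sup>2 + (n (y j t))\<^sup>2"
        using sum_squares_bound [of "n (y i t)" "n (y j t)"] by (simp add: mult.assoc)
      finally have "2 * (n (y i t) * y j t) \<le> (n (y i t))\<^sup>2 + (n (y j t))\<^sup>2" by simp
      then have "N i j t * (2 * (n (y i t) * y j t)) \<le> N i j t * ((n (y i t))\<^sup>2 + (n (y j t))\<^sup>2)"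
        using N that \<open>t \<ge> 0\<close> by (intro mult_left_mono) auto
      also have "\<dots> \<le> C * ((n (y i t))\<^sup>2 + (n (y j t))\<^sup>2)"
        using N that \<open>t \<ge> 0\<close> by (intro mult_right_mono) auto
      finally show ?thesis by (simp add: algebra_simps)
    qed
    have "(\<Sum>i\<in>I. 2 * n (y i t) * (\<Sum>j\<in>I. N i j t * y j t)) =
        (\<Sum>i\<in>I. \<Sum>j\<in>I. 2 * n (y i t) * (N i j t * y j t))"
      by (simp add: sum_distrib_left)
    also have "\<dots> \<le> (\<Sum>i\<in>I. \<Sum>j\<in>I. C * ((n (y i t))\<^sup>2 + (n (y j t))\<^sup>2))"
      by (intro sum_mono 1)
    also have "\<dots> = K * F t"
      by (simp add: sum.distrib sum_distrib_left [symmetric] F_def K_def algebra_simps)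
    finally show ?thesis .
  qed
  \<comment> \<open>Gronwall by an integrating factor; the minus sign makes the function
    nondecreasing.\<close>
  define H where "H t = - (F t * exp (- K * t))" for t
  have "H 0 \<le> H T"
  proof -
    let ?D = "\<lambda>t. (K * F t - (\<Sum>i\<in>I. 2 * n (y i t) * (\<Sum>j\<in>I. N i j t * y j t))) * exp (- K * t)"
    show ?thesis
    proof (rule nondecreasing_on_Ici [where f = H and D = ?D])
      fix t :: real
      show "t \<ge> 0 \<Longrightarrow> (H has_real_derivative ?D t) (at t within {0..})"
        unfolding H_def by (auto intro!: derivative_eq_intros derF simp: algebra_simps)
      show "t > 0 \<Longrightarrow> 0 \<le> ?D t" using le [of t] by simp
    qed (use \<open>T \<ge> 0\<close> in auto)
  qed
  moreover have "F 0 = 0" using init by (simp add: F_def n_def)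
  ultimately have "F T \<le> 0" by (simp add: H_def mult_le_0_iff)
  moreover have "(n (y k T))\<^sup>2 \<le> F T"
    unfolding F_def using assms by (intro member_le_sum) auto
  ultimately have "(n (y k T))\<^sup>2 \<le> 0" by linarith
  then have "n (y k T) = 0" by simp
  then show ?thesis by (simp add: n_def min_def split: if_splits)
qed

section \<open>Uniqueness for planar linear systems\<close>

definition planar_solution ::
  "(real \<Rightarrow> real) \<Rightarrow> (real \<Rightarrow> real) \<Rightarrow> (real \<Rightarrow> real) \<Rightarrow> (real \<Rightarrow> real) \<Rightarrow> (real \<Rightarrow> real) \<Rightarrow> bool" where
  "planar_solution m11 m12 m22 u v \<longleftrightarrow> (\<forall>t\<ge>0.
     (u has_real_derivative m11 t * u t + m12 t * v t) (at t within {0..}) \<and>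
     (v has_real_derivative m12 t * u t + m22 t * v t) (at t within {0..}))"

lemma planar_solution_lincomb:
  assumes "planar_solution m11 m12 m22 u v" "planar_solution m11 m12 m22 u' v'"
  shows "planar_solution m11 m12 m22 (\<lambda>t. k * u t + k' * u' t) (\<lambda>t. k * v t + k' * v' t)"
  using assms unfolding planar_solution_def
  by (auto intro!: derivative_eq_intros simp: algebra_simps)

text \<open>Every Wronskian of two solutions satisfies W' = (trace M) W, so quotients of Wronskians
  are conserved.\<close>

lemma wronskian_ratio_constant:
  assumes "planar_solution m11 m12 m22 u1 v1" "planar_solution m11 m12 m22 u2 v2"
    and "planar_solution m11 m12 m22 y z"
    and det: "\<And>t. t \<ge> 0 \<Longrightarrow> u1 t * v2 t - u2 t * v1 t \<noteq> 0" and "t \<ge> 0"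
  shows "(y t * v2 t - u2 t * z t) / (u1 t * v2 t - u2 t * v1 t) =
    (y 0 * v2 0 - u2 0 * z 0) / (u1 0 * v2 0 - u2 0 * v1 0)"
proof -
  define w where "w t = (y t * v2 t - u2 t * z t) / (u1 t * v2 t - u2 t * v1 t)" for t
  have wr: "((\<lambda>t. a t * v2 t - u2 t * b t) has_real_derivative
      (m11 t + m22 t) * (a t * v2 t - u2 t * b t)) (at t within {0..})"
    if "planar_solution m11 m12 m22 a b" "t \<ge> 0" for a b t
    using that assms(2) unfolding planar_solution_def
    by (auto intro!: derivative_eq_intros simp: algebra_simps)
  have "(w has_real_derivative 0) (at t within {0..})" if "t \<ge> 0" for t
    unfolding w_def using DERIV_divide [OF wr [OF assms(3) that] wr [OF assms(1) that] det [OF that]]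
    by (simp add: algebra_simps)
  then obtain k where "\<And>t. t \<in> {0..} \<Longrightarrow> w t = k"
    using has_field_derivative_zero_constant [of "{0..}" w] by auto
  then show ?thesis using \<open>t \<ge> 0\<close> unfolding w_def by simp
qed

text \<open>Cramer's rule expresses a solution in the fundamental system, and its coefficients are
  the conserved quotients.\<close>

lemma planar_solution_unique:
  assumes sol: "planar_solution m11 m12 m22 u1 v1" "planar_solution m11 m12 m22 u2 v2"
    and init: "u1 0 = 1" "v1 0 = 0" "u2 0 = 0" "v2 0 = 1"
    and det: "\<And>t. t \<ge> 0 \<Longrightarrow> u1 t * v2 t - u2 t * v1 t \<noteq> 0"
    and yz: "planar_solution m11 m12 m22 y z" and "t \<ge> 0"
  shows "y t = u1 t * y 0 + u2 t * z 0" and "z t = v1 t * y 0 + v2 t * z 0"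
proof -
  define D where "D = u1 t * v2 t - u2 t * v1 t"
  have "D \<noteq> 0" using det \<open>t \<ge> 0\<close> by (simp add: D_def)
  have det': "u2 t * v1 t - u1 t * v2 t \<noteq> 0" if "t \<ge> 0" for t using det [OF that] by simp
  have 1: "y t * v2 t - u2 t * z t = y 0 * D"
    using wronskian_ratio_constant [OF sol yz det \<open>t \<ge> 0\<close>] \<open>D \<noteq> 0\<close> init
    by (simp add: D_def divide_eq_eq)
  have "(y t * v1 t - u1 t * z t) / - D = z 0"
    using wronskian_ratio_constant [OF sol(2,1) yz det' \<open>t \<ge> 0\<close>] init
    by (simp add: D_def)
  then have 2: "u1 t * z t - y t * v1 t = z 0 * D"
    using \<open>D \<noteq> 0\<close> by (simp add: field_simps)
  have "y t * D = u1 t * (y t * v2 t - u2 t * z t) + u2 t * (u1 t * z t - y t * v1 t)"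
    by (simp add: D_def algebra_simps)
  also have "\<dots> = (u1 t * y 0 + u2 t * z 0) * D" unfolding 1 2 by (simp add: algebra_simps)
  finally show "y t = u1 t * y 0 + u2 t * z 0" using \<open>D \<noteq> 0\<close> by simp
  have "z t * D = v1 t * (y t * v2 t - u2 t * z t) + v2 t * (u1 t * z t - y t * v1 t)"
    by (simp add: D_def algebra_simps)
  also have "\<dots> = (v1 t * y 0 + v2 t * z 0) * D" unfolding 1 2 by (simp add: algebra_simps)
  finally show "z t = v1 t * y 0 + v2 t * z 0" using \<open>D \<noteq> 0\<close> by simp
qed


section \<open>The heat flow between the two Gaussians\<close>

text \<open>In terms of \<open>r = exp (- t)\<close>, the Gaussian \<open>\<nu>\<^sub>t\<close> has the covariance matrix
  \<open>A\<inverse> - A\<inverse> exp (- t A) (A\<inverse> + B\<inverse>)\<inverse> exp (- t A) A\<inverse>\<close>, with first row \<open>cov11 r\<close>, \<open>r\<^sup>3 / 8\<close> and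
  determinant \<open>cov_det r\<close>; the velocity field at time \<open>t\<close> has the matrix \<open>vel11\<close>, \<open>vel12\<close>, \<open>vel22\<close>.\<close>

definition cov11 :: "real \<Rightarrow> real" where
  "cov11 r = 1 - 5 / 8 * r^2"

definition cov_det :: "real \<Rightarrow> real" where
  "cov_det r = 1 / 2 - 5 / 16 * r^2 - r^4 / 8 + r^6 / 16"

text \<open>The matrix with entries \<open>vel11\<close>, \<open>vel12\<close>, \<open>vel22\<close>
  is the inverse covariance of \<nu> at time t minus A, because the semigroup applied to f is the
  density of that measure relative to \<mu>.\<close>

definition vel11 :: "real \<Rightarrow> real" where
  "vel11 t = exp (- t)^2 * (5 - exp (- t)^4) / (16 * cov_det (exp (- t)))"

definition vel12 :: "real \<Rightarrow> real" where
  "vel12 t = - (exp (- t)^3) / (8 * cov_det (exp (- t)))"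

definition vel22 :: "real \<Rightarrow> real" where
  "vel22 t = exp (- t)^4 * (2 - exp (- t)^2) / (8 * cov_det (exp (- t)))"

lemma cov11_pos: "0 \<le> r \<Longrightarrow> r \<le> 1 \<Longrightarrow> 0 < cov11 r"
  using power_le_one [of r 2] by (simp add: cov11_def)

text \<open>A bound uniform in r keeps the velocity coefficients bounded for all times, including
  the limit r = 0.\<close>

lemma cov_det_lower:
  assumes "0 \<le> r" "r \<le> 1"
  shows "1 / 16 \<le> cov_det r"
  using power_le_one [OF assms, of 2] power_le_one [OF assms, of 4] zero_le_power [OF assms(1), of 6]
  unfolding cov_det_def by linarith

text \<open>The flow carries \<nu> to its evolution, so the covariance C satisfies C' = M C + C M.
  With Cholesky factor L of C and a rotation R, the solution is S = L R times the inverse of the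
  initial L, and det S is the quotient of the values of \<eta>.\<close>

lemma heat_flow_exists:
  obtains u1 v1 u2 v2 :: "real \<Rightarrow> real" and a b c d :: real
  where "planar_solution vel11 vel12 vel22 u1 v1" "planar_solution vel11 vel12 vel22 u2 v2"
    and "u1 0 = 1" "v1 0 = 0" "u2 0 = 0" "v2 0 = 1"
    and "\<And>t. t \<ge> 0 \<Longrightarrow> u1 t * v2 t - u2 t * v1 t \<noteq> 0"
    and "(u1 \<longlongrightarrow> a) at_top" "(u2 \<longlongrightarrow> b) at_top" "(v1 \<longlongrightarrow> c) at_top" "(v2 \<longlongrightarrow> d) at_top"
    and "a * d - b * c \<noteq> 0"
proof -
  \<comment> \<open>The derivative of the angle in t is r times this function, and dr = -r dt. In
    the variable r the integral runs over the compact interval [0, 1], so the angle has a limit as t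
    tends to infinity.\<close>
  define \<psi> where "\<psi> r = r^2 / (8 * sqrt (cov_det r) * cov11 r)" for r
  have pos: "0 < cov11 r" "0 < cov_det r" if "0 \<le> r" "r \<le> 1" for r
    using cov11_pos [OF that] cov_det_lower [OF that] by auto
  have cont: "continuous_on {0..1} \<psi>"
  proof -
    have "continuous_on {0..1} cov_det" "continuous_on {0..1} cov11"
      unfolding cov_det_def cov11_def by (auto intro!: continuous_intros)
    then show ?thesis
      unfolding \<psi>_def using pos by (intro continuous_intros) (auto simp: less_imp_neq [symmetric])
  qed
  obtain \<Psi> where \<Psi>: "\<And>r. r \<in> {0..1} \<Longrightarrow> (\<Psi> has_vector_derivative \<psi> r) (at r within {0..1})"
    using antiderivative_continuous [OF cont] by blast
  then have \<Psi>_cont: "continuous_on {0..1} \<Psi>"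
    by (intro continuous_on_vector_derivative) auto
  define \<alpha> where "\<alpha> t = sqrt (cov11 (exp (- t)))" for t
  define \<eta> where "\<eta> t = sqrt (cov_det (exp (- t)))" for t
  define c where "c t = exp (- t)^3 / 8" for t :: real
  define \<theta> where "\<theta> t = \<Psi> 1 - \<Psi> (exp (- t))" for t
  have \<alpha>\<eta>: "0 < \<alpha> t" "0 < \<eta> t" "(\<alpha> t)\<^sup>2 = cov11 (exp (- t))" "(\<eta> t)\<^sup>2 = cov_det (exp (- t))"
    if "t \<ge> 0" for t
    using pos [of "exp (- t)"] that by (auto simp: \<alpha>_def \<eta>_def)
  \<comment> \<open>The shift \<tau> selects the initial direction: \<tau> = 0 and \<tau> = pi / 2
    give the two columns of L R.\<close>
  define U where "U \<tau> t = \<alpha> t * cos (\<theta> t + \<tau>)" for \<tau> t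
  define V where "V \<tau> t = (c t * cos (\<theta> t + \<tau>) + \<eta> t * sin (\<theta> t + \<tau>)) / \<alpha> t" for \<tau> t
  have sol: "planar_solution vel11 vel12 vel22 (U \<tau>) (V \<tau>)" for \<tau>
    unfolding planar_solution_def
  proof (intro allI impI)
    fix t :: real assume "t \<ge> 0"
    define r where "r = exp (- t)"
    have r: "0 \<le> r" "r \<le> 1" using \<open>t \<ge> 0\<close> by (auto simp: r_def)
    note p = pos [OF r]
    have at: "\<alpha> t > 0" "\<eta> t > 0" and sq: "(\<alpha> t)\<^sup>2 = cov11 r" "(\<eta> t)\<^sup>2 = cov_det r"
      using \<alpha>\<eta> [OF \<open>t \<ge> 0\<close>] by (auto simp: r_def)
    have ct: "c t = r^3 / 8" by (simp add: c_def r_def)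
    have vel: "vel11 t = r^2 * (5 - r^4) / (16 * cov_det r)" "vel12 t = - (r^3) / (8 * cov_det r)"
        "vel22 t = r^4 * (2 - r^2) / (8 * cov_det r)"
      by (simp_all add: vel11_def vel12_def vel22_def r_def)
    \<comment> \<open>The identities \<open>id1\<close> to \<open>id4\<close> express C' = M C + C
      M: half of the (1, 1) entry, half of the derivative of det C as trace times determinant, the
      value of C22, and the (1, 2) entry.\<close>
    have "vel11 t * cov11 r + vel12 t * c t =
        (r^2 * (5 - r^4) * cov11 r / 16 - r^6 / 64) / cov_det r"
      using p(2) unfolding vel ct by (simp add: field_simps flip: power_add)
    also have "r^2 * (5 - r^4) * cov11 r / 16 - r^6 / 64 = 5 / 8 * r^2 * cov_det r"
      unfolding cov11_def cov_det_def by (simp add: field_simps flip: power_add)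
    finally have id1: "vel11 t * cov11 r + vel12 t * c t = 5 / 8 * r^2" using p(2) by simp
    have "vel11 t + vel22 t = (r^2 * (5 - r^4) / 16 + r^4 * (2 - r^2) / 8) / cov_det r"
      using p(2) unfolding vel by (simp add: field_simps flip: power_add)
    then have id2: "(vel11 t + vel22 t) * cov_det r = r^2 * (5 - r^4) / 16 + r^4 * (2 - r^2) / 8"
      using p(2) by simp
    have id3: "((\<eta> t)\<^sup>2 + (c t)\<^sup>2) / (\<alpha> t)\<^sup>2 = 1 / 2 - r^4 / 8"
      unfolding sq ct using p(1) unfolding cov11_def cov_det_def
      by (simp add: field_simps power_divide flip: power_add power_mult)
    have "(vel11 t + vel22 t) * c t + vel12 t * ((1 / 2 - r^4 / 8) + cov11 r) =
        ((r^2 * (5 - r^4) / 16 + r^4 * (2 - r^2) / 8) * r^3 / 8 - r^3 / 8 * ((1 / 2 - r^4 / 8) + cov11 r)) / cov_det r"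
      using p(2) unfolding vel ct by (simp add: field_simps flip: power_add)
    also have "(r^2 * (5 - r^4) / 16 + r^4 * (2 - r^2) / 8) * r^3 / 8 - r^3 / 8 * ((1 / 2 - r^4 / 8) + cov11 r) =
        - 3 / 8 * r^3 * cov_det r"
      unfolding cov11_def cov_det_def by (simp add: field_simps flip: power_add)
    finally have id4: "(vel11 t + vel22 t) * c t + vel12 t * ((1 / 2 - r^4 / 8) + cov11 r) = - 3 / 8 * r^3"
      using p(2) by simp
    have dexp: "((\<lambda>t. exp (- t)) has_real_derivative - r) (at t within {0..})"
      by (auto intro!: derivative_eq_intros simp: r_def)
    have "(\<alpha> has_real_derivative (5 / 4 * r^2) / (2 * \<alpha> t)) (at t within {0..})"
      unfolding \<alpha>_def cov11_def using p(1) unfolding cov11_def r_def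
      by (auto intro!: derivative_eq_intros simp: field_simps power2_eq_square)
    also have "(5 / 4 * r^2) / (2 * \<alpha> t) = vel11 t * \<alpha> t + vel12 t * c t / \<alpha> t"
      using id1 at(1) by (simp add: field_simps flip: sq(1) power2_eq_square)
    finally have d\<alpha>: "(\<alpha> has_real_derivative vel11 t * \<alpha> t + vel12 t * c t / \<alpha> t) (at t within {0..})" .
    have "((\<lambda>t. cov_det (exp (- t))) has_real_derivative (5 / 8 * r^2 + r^4 / 2 - 3 / 8 * r^6)) (at t within {0..})"
      unfolding cov_det_def r_def
      by (auto intro!: derivative_eq_intros simp: field_simps eval_nat_numeral)
    from DERIV_chain2 [OF DERIV_real_sqrt [OF p(2) [unfolded r_def]] this]
    have "(\<eta> has_real_derivative inverse (\<eta> t) / 2 * (5 / 8 * r^2 + r^4 / 2 - 3 / 8 * r^6)) (at t within {0..})"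
      unfolding \<eta>_def by simp
    also have "5 / 8 * r^2 + r^4 / 2 - 3 / 8 * r^6 = 2 * ((vel11 t + vel22 t) * cov_det r)"
      unfolding id2 by (simp add: field_simps flip: power_add)
    also have "inverse (\<eta> t) / 2 * \<dots> = (vel11 t + vel22 t) * \<eta> t"
      using at(2) unfolding sq(2) [symmetric] by (simp add: field_simps power2_eq_square)
    finally have d\<eta>: "(\<eta> has_real_derivative (vel11 t + vel22 t) * \<eta> t) (at t within {0..})" .
    have "(c has_real_derivative - 3 / 8 * r^3) (at t within {0..})"
      unfolding c_def r_def by (auto intro!: derivative_eq_intros simp: field_simps eval_nat_numeral)
    then have dc: "(c has_real_derivative (vel11 t + vel22 t) * c t +
        vel12 t * (((\<eta> t)\<^sup>2 + (c t)\<^sup>2) / (\<alpha> t)\<^sup>2 + (\<alpha> t)\<^sup>2)) (at t within {0..})"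
      unfolding id3 unfolding sq(1) id4 .
    \<comment> \<open>At t = 0 only the one-sided derivative of the antiderivative at r = 1 exists,
      so the chain rule is used within the image of the half-line.\<close>
    have "(\<Psi> has_real_derivative \<psi> r) (at r within (\<lambda>t. exp (- t)) ` {0..})"
      using \<Psi> [of r] r unfolding has_real_derivative_iff_has_vector_derivative
      by (auto intro: has_vector_derivative_within_subset)
    from DERIV_image_chain [OF this [unfolded r_def] dexp]
    have "((\<lambda>t. \<Psi> (exp (- t))) has_real_derivative \<psi> r * - r) (at t within {0..})"
      by (simp add: o_def r_def)
    then have "((\<lambda>t. \<theta> t + \<tau>) has_real_derivative \<psi> r * r) (at t within {0..})"
      unfolding \<theta>_def by (auto intro!: derivative_eq_intros)
    also have "\<psi> r * r = r^3 / (8 * \<eta> t * (\<alpha> t)\<^sup>2)"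
      unfolding \<psi>_def sq(1) by (simp add: \<eta>_def r_def eval_nat_numeral)
    also have "\<dots> = - vel12 t * \<eta> t / (\<alpha> t)\<^sup>2"
      unfolding vel sq(2) [symmetric] using at by (simp add: field_simps power2_eq_square)
    finally have d\<theta>: "((\<lambda>t. \<theta> t + \<tau>) has_real_derivative - vel12 t * \<eta> t / (\<alpha> t)\<^sup>2) (at t within {0..})" .
    show "(U \<tau> has_real_derivative vel11 t * U \<tau> t + vel12 t * V \<tau> t) (at t within {0..}) \<and>
        (V \<tau> has_real_derivative vel12 t * U \<tau> t + vel22 t * V \<tau> t) (at t within {0..})"
      unfolding U_def V_def
      using cholesky_rotation_derivatives [OF at(1) d\<alpha> d\<eta> dc d\<theta>] by blast
  qed
  \<comment> \<open>With 1 / \<open>\<alpha> 0\<close>, the numbers l and k are the entries of the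
    inverse of the initial Cholesky factor.\<close>
  define k where "k = \<alpha> 0 / \<eta> 0"
  define l where "l = - c 0 / (\<alpha> 0 * \<eta> 0)"
  define u1 where "u1 t = 1 / \<alpha> 0 * U 0 t + l * U (pi / 2) t" for t
  define v1 where "v1 t = 1 / \<alpha> 0 * V 0 t + l * V (pi / 2) t" for t
  define u2 where "u2 t = 0 * U 0 t + k * U (pi / 2) t" for t
  define v2 where "v2 t = 0 * V 0 t + k * V (pi / 2) t" for t
  have \<theta>0: "\<theta> 0 = 0" by (simp add: \<theta>_def)
  have pos0: "\<alpha> 0 > 0" "\<eta> 0 > 0" using \<alpha>\<eta> by auto
  have UV_det: "U 0 t * V (pi / 2) t - U (pi / 2) t * V 0 t = \<eta> t" if "t \<ge> 0" for t
  proof -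
    have "U 0 t * V (pi / 2) t - U (pi / 2) t * V 0 t = \<eta> t * ((cos (\<theta> t))\<^sup>2 + (sin (\<theta> t))\<^sup>2)"
      using \<alpha>\<eta>(1) [OF that] unfolding U_def V_def
      by (simp add: cos_add sin_add) (simp add: field_simps power2_eq_square, simp flip: distrib_left)
    then show ?thesis by simp
  qed
  have det: "u1 t * v2 t - u2 t * v1 t = \<eta> t / \<eta> 0" if "t \<ge> 0" for t
  proof -
    have "u1 t * v2 t - u2 t * v1 t = (1 / \<alpha> 0 * k) * (U 0 t * V (pi / 2) t - U (pi / 2) t * V 0 t)"
      unfolding u1_def u2_def v1_def v2_def by (simp add: algebra_simps)
    then show ?thesis unfolding UV_det [OF that] using pos0 by (simp add: k_def)
  qed
  have r0: "((\<lambda>t. exp (- t)) \<longlongrightarrow> (0::real)) at_top"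
    by (intro filterlim_compose [OF exp_at_bot] filterlim_uminus_at_bot_at_top)
  define \<beta> where "\<beta> = \<Psi> 1 - \<Psi> 0"
  have lim\<theta>: "(\<theta> \<longlongrightarrow> \<beta>) at_top"
    unfolding \<theta>_def \<beta>_def
    by (intro tendsto_diff tendsto_const continuous_on_tendsto_compose [OF \<Psi>_cont r0])
      (auto intro!: eventually_mono [OF eventually_ge_at_top [of 0]])
  have "(\<alpha> \<longlongrightarrow> sqrt (1 - 5 / 8 * 0^2)) at_top"
    unfolding \<alpha>_def cov11_def by (intro tendsto_intros r0)
  then have lim\<alpha>: "(\<alpha> \<longlongrightarrow> 1) at_top" by simp
  have "(\<eta> \<longlongrightarrow> sqrt (1 / 2 - 5 / 16 * 0^2 - 0^4 / 8 + 0^6 / 16)) at_top"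
    unfolding \<eta>_def cov_det_def by (intro tendsto_intros r0) auto
  then have lim\<eta>: "(\<eta> \<longlongrightarrow> sqrt (1 / 2)) at_top" by simp
  have "(c \<longlongrightarrow> 0^3 / 8) at_top"
    unfolding c_def by (intro tendsto_intros r0) auto
  then have limc: "(c \<longlongrightarrow> 0) at_top" by simp
  have limU: "(U \<tau> \<longlongrightarrow> 1 * cos (\<beta> + \<tau>)) at_top" for \<tau>
    unfolding U_def by (intro tendsto_intros lim\<theta> lim\<alpha>)
  have limV: "(V \<tau> \<longlongrightarrow> (0 * cos (\<beta> + \<tau>) + sqrt (1 / 2) * sin (\<beta> + \<tau>)) / 1) at_top" for \<tau>
    unfolding V_def by (intro tendsto_intros lim\<theta> lim\<alpha> lim\<eta> limc) simp
  have "\<exists>a b c d. (u1 \<longlongrightarrow> a) at_top \<and> (u2 \<longlongrightarrow> b) at_top \<and> (v1 \<longlongrightarrow> c) at_top \<and> (v2 \<longlongrightarrow> d) at_top"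
    unfolding u1_def u2_def v1_def v2_def
    by (rule exI conjI tendsto_add tendsto_mult tendsto_const limU limV)+
  then obtain a b c' d where lims: "(u1 \<longlongrightarrow> a) at_top" "(u2 \<longlongrightarrow> b) at_top" "(v1 \<longlongrightarrow> c') at_top" "(v2 \<longlongrightarrow> d) at_top"
    by blast
  have "((\<lambda>t. u1 t * v2 t - u2 t * v1 t) \<longlongrightarrow> a * d - b * c') at_top"
    by (intro tendsto_intros lims)
  moreover have "((\<lambda>t. u1 t * v2 t - u2 t * v1 t) \<longlongrightarrow> sqrt (1 / 2) / \<eta> 0) at_top"
  proof (rule Lim_transform_eventually)
    show "((\<lambda>t. \<eta> t / \<eta> 0) \<longlongrightarrow> sqrt (1 / 2) / \<eta> 0) at_top"
      using pos0 by (intro tendsto_intros lim\<eta>) auto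
    show "\<forall>\<^sub>F t in at_top. \<eta> t / \<eta> 0 = u1 t * v2 t - u2 t * v1 t"
      using eventually_ge_at_top [of 0] by eventually_elim (simp add: det)
  qed
  ultimately have "a * d - b * c' = sqrt (1 / 2) / \<eta> 0"
    by (intro tendsto_unique [of at_top]) auto
  moreover have "sqrt (1 / 2) / \<eta> 0 \<noteq> 0" using pos0 by simp
  ultimately have nz: "a * d - b * c' \<noteq> 0" by simp
  show thesis
  proof (rule that [OF _ _ _ _ _ _ _ lims nz])
    show "planar_solution vel11 vel12 vel22 u1 v1" "planar_solution vel11 vel12 vel22 u2 v2"
      unfolding u1_def u2_def v1_def v2_def by (rule planar_solution_lincomb [OF sol sol])+
    show "u1 0 = 1" "v1 0 = 0" "u2 0 = 0" "v2 0 = 1"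
      using pos0 by (auto simp: u1_def v1_def u2_def v2_def U_def V_def \<theta>0 k_def l_def field_simps)
    show "u1 t * v2 t - u2 t * v1 t \<noteq> 0" if "t \<ge> 0" for t
      using det [OF that] \<alpha>\<eta>(2) [OF that] pos0 by simp
  qed
qed

text \<open>With \<open>M\<close> the matrix of the velocity field, set \<open>x = (M\<^sub>1\<^sub>1 - M\<^sub>2\<^sub>2) / 2\<close> and \<open>\<kappa> = M\<^sub>1\<^sub>2 / x\<close>. For a matrix
  \<open>S\<close> with \<open>S' = M S\<close> write \<open>p = (S\<^sub>1\<^sub>1 + S\<^sub>2\<^sub>2) / 2\<close>, \<open>b = (S\<^sub>1\<^sub>1 - S\<^sub>2\<^sub>2) / 2\<close>, \<open>q = (S\<^sub>2\<^sub>1 - S\<^sub>1\<^sub>2) / 2\<close>,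
  \<open>s = (S\<^sub>2\<^sub>1 + S\<^sub>1\<^sub>2) / 2\<close>. Since \<open>x\<close> and \<open>\<kappa>'\<close> are positive, the system satisfied by \<open>h = p + \<kappa> q\<close>, \<open>b\<close>,
  \<open>q\<close> and \<open>g = \<kappa> b - s\<close> is cooperative, which forces \<open>q > 0\<close>.\<close>

lemma cooperative_shear_antisymmetric_pos:
  fixes m11 m12 m22 \<kappa> :: "real \<Rightarrow> real"
  defines "x \<equiv> \<lambda>t. (m11 t - m22 t) / 2" and "m \<equiv> \<lambda>t. (m11 t + m22 t) / 2"
  assumes sol: "planar_solution m11 m12 m22 u1 v1" "planar_solution m11 m12 m22 u2 v2"
    and init: "u1 0 = 1" "v1 0 = 0" "u2 0 = 0" "v2 0 = 1"
    and \<kappa>: "\<And>t. t \<ge> 0 \<Longrightarrow> (\<kappa> has_real_derivative \<kappa>' t) (at t within {0..})"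
    and m12: "\<And>t. t \<ge> 0 \<Longrightarrow> m12 t = x t * \<kappa> t"
    and bounds: "\<And>t. t \<ge> 0 \<Longrightarrow> 0 < x t \<and> x t * (1 + (\<kappa> t)\<^sup>2) \<le> C"
      "\<And>t. t \<ge> 0 \<Longrightarrow> 0 \<le> m t \<and> m t \<le> C" "\<And>t. t \<ge> 0 \<Longrightarrow> 0 < \<kappa>' t \<and> \<kappa>' t \<le> C"
    and lim: "(u2 \<longlongrightarrow> b') at_top" "(v1 \<longlongrightarrow> c') at_top"
  shows "b' < c'"
proof -
  define b where "b t = (u1 t - v2 t) / 2" for t
  define q where "q t = (v1 t - u2 t) / 2" for t
  define h where "h t = (u1 t + v2 t) / 2 + \<kappa> t * q t" for t
  define g where "g t = \<kappa> t * b t - (v1 t + u2 t) / 2" for t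
  have m11: "m11 t = m t + x t" "m22 t = m t - x t" for t by (simp_all add: m_def x_def field_simps)
  have u: "(u1 has_real_derivative (m t + x t) * u1 t + x t * \<kappa> t * v1 t) (at t within {0..})"
      "(u2 has_real_derivative (m t + x t) * u2 t + x t * \<kappa> t * v2 t) (at t within {0..})"
      "(v1 has_real_derivative x t * \<kappa> t * u1 t + (m t - x t) * v1 t) (at t within {0..})"
      "(v2 has_real_derivative x t * \<kappa> t * u2 t + (m t - x t) * v2 t) (at t within {0..})"
    if "t \<ge> 0" for t
    using sol that unfolding planar_solution_def m11 m12 [OF that, symmetric] by auto
  let ?w = "\<lambda>t. x t * (1 + (\<kappa> t)\<^sup>2)"
  \<comment> \<open>The combinations h and g absorb every product with \<kappa>: the s terms in the
    derivative of h cancel, and differentiating \<kappa> contributes only the positive couplings by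
    \<kappa>'.\<close>
  have der:
    "(h has_real_derivative m t * h t + ?w t * b t + \<kappa>' t * q t) (at t within {0..})"
    "(b has_real_derivative x t * h t + m t * b t) (at t within {0..})"
    "(q has_real_derivative m t * q t + x t * g t) (at t within {0..})"
    "(g has_real_derivative \<kappa>' t * b t + ?w t * q t + m t * g t) (at t within {0..})"
    if "t \<ge> 0" for t
    unfolding h_def [abs_def] b_def [abs_def] q_def [abs_def] g_def [abs_def]
    by (auto intro!: derivative_eq_intros u [OF that] \<kappa> [OF that] simp: field_simps power2_eq_square)
  define y where "y i = [h, b, q, g] ! i" for i
  define N where "N i j t =
    [[m t, ?w t, \<kappa>' t, 0], [x t, m t, 0, 0], [0, 0, m t, x t], [0, \<kappa>' t, ?w t, m t]] ! i ! j" for i j t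
  have nonneg: "0 \<le> y i t" if "t \<ge> 0" "i \<in> {0, 1, 2, 3}" for i t
  proof (rule cooperative_linear_nonneg [where I = "{0, 1, 2, 3}" and N = N and C = C and y = y and k = i and T = t])
    fix i j :: nat and t :: real
    assume ij: "i \<in> {0, 1, 2, 3}" and "t \<ge> 0"
    show "(y i has_real_derivative (\<Sum>j\<in>{0, 1, 2, 3}. N i j t * y j t)) (at t within {0..})"
      using ij der [OF \<open>t \<ge> 0\<close>] by (auto simp: y_def N_def ac_simps)
    have "x t * 1 \<le> ?w t" using bounds(1) [OF \<open>t \<ge> 0\<close>] by (intro mult_left_mono) auto
    then have "x t \<le> C" using bounds(1) [OF \<open>t \<ge> 0\<close>] by linarith
    then show "j \<in> {0, 1, 2, 3} \<Longrightarrow> 0 \<le> N i j t \<and> N i j t \<le> C"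
      using ij bounds [OF \<open>t \<ge> 0\<close>] by (auto simp: N_def)
  next
    fix i :: nat assume "i \<in> {0, 1, 2, 3}"
    then show "0 \<le> y i 0" using init by (auto simp: y_def h_def b_def q_def g_def)
  qed (use that in auto)
  have nn: "0 \<le> h t" "0 \<le> b t" "0 \<le> q t" "0 \<le> g t" if "t \<ge> 0" for t
    using nonneg [OF that, of 0] nonneg [OF that, of 1] nonneg [OF that, of 2] nonneg [OF that, of 3]
    by (simp_all add: y_def)
  have pos: "0 < x t" "0 < \<kappa>' t" "0 \<le> m t" "0 < ?w t" if "t \<ge> 0" for t
    using bounds [OF that] by (auto intro!: mult_pos_pos add_pos_nonneg)
  \<comment> \<open>Strict signs travel along h, b, g, q: h drives b through \<open>x\<close>, b
    drives g through \<kappa>', and g drives q through \<open>x\<close>. The middle link is where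
    the rotation of the eigenvectors enters.\<close>
  have h: "1 \<le> h t" if "t \<ge> 0" for t
  proof -
    have "h 0 \<le> h t"
      by (rule nondecreasing_on_Ici [OF der(1)]) (use nn pos that in \<open>auto intro!: add_nonneg_nonneg mult_nonneg_nonneg simp: less_imp_le\<close>)
    then show ?thesis using init by (simp add: h_def q_def)
  qed
  have b: "0 < b t" if "t > 0" for t
  proof -
    have "b 0 < b t"
    proof (rule increasing_on_Ici [OF der(2)])
      show "0 < x t * h t + m t * b t" if "t > 0" for t
        using that h [of t] nn [of t] pos [of t] by (intro add_pos_nonneg mult_pos_pos mult_nonneg_nonneg) auto
    qed (use that in auto)
    then show ?thesis using init by (simp add: b_def)
  qed
  have g: "0 < g t" if "t > 0" for t
  proof -
    have "g 0 < g t"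
    proof (rule increasing_on_Ici [OF der(4)])
      show "0 < \<kappa>' t * b t + ?w t * q t + m t * g t" if "t > 0" for t
        using that b [of t] nn [of t] pos [of t] by (intro add_pos_nonneg mult_pos_pos mult_nonneg_nonneg) auto
    qed (use that in auto)
    then show ?thesis using init by (simp add: b_def g_def)
  qed
  have q: "q s < q t" if "0 \<le> s" "s < t" for s t
  proof (rule increasing_on_Ici [OF der(3)])
    show "0 < m t * q t + x t * g t" if "t > 0" for t
      using that g [of t] nn [of t] pos [of t] by (intro add_nonneg_pos mult_pos_pos mult_nonneg_nonneg) auto
  qed (use that in auto)
  \<comment> \<open>Monotonicity of q keeps the inequality strict in the limit.\<close>
  have "0 < q 1" using q [of 0 1] init by (simp add: q_def)
  also have "q 1 \<le> (c' - b') / 2"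
  proof (rule tendsto_lowerbound)
    show "(q \<longlongrightarrow> (c' - b') / 2) at_top"
      unfolding q_def [abs_def] by (intro tendsto_intros lim) simp
    show "\<forall>\<^sub>F t in at_top. q 1 \<le> q t"
      using eventually_gt_at_top [of 1] by eventually_elim (simp add: q less_imp_le)
  qed simp
  finally show ?thesis by simp
qed

lemma heat_flow_limit_not_symmetric:
  assumes sol: "planar_solution vel11 vel12 vel22 u1 v1" "planar_solution vel11 vel12 vel22 u2 v2"
    and init: "u1 0 = 1" "v1 0 = 0" "u2 0 = 0" "v2 0 = 1"
    and lim: "(u2 \<longlongrightarrow> b) at_top" "(v1 \<longlongrightarrow> c) at_top"
  shows "b < c"
proof -
  define \<kappa> where "\<kappa> t = - 4 * exp (- t) / (5 - 4 * exp (- t)^2 + exp (- t)^4)" for t :: real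
  define \<kappa>' where "\<kappa>' t = 4 * exp (- t) * (5 + 4 * exp (- t)^2 - 3 * exp (- t)^4)
    / (5 - 4 * exp (- t)^2 + exp (- t)^4)^2" for t :: real
  have w_pos: "5 - 4 * r^2 + r^4 > 0" for r :: real
  proof -
    have "5 - 4 * r^2 + r^4 = (r^2 - 2)^2 + 1" by (simp add: power2_eq_square eval_nat_numeral algebra_simps)
    also have "\<dots> > 0" by (intro add_nonneg_pos) auto
    finally show ?thesis .
  qed
  show ?thesis
  \<comment> \<open>The value 20 is generous: the estimates below give 25/2 for the coefficient with
    1 + \<kappa>^2, 9/2 for the half trace, and 36 / w^2 with w \<ge> 2 for \<kappa>'.\<close>
  proof (rule cooperative_shear_antisymmetric_pos [OF sol init _ _ _ _ _ lim, where \<kappa> = \<kappa> and \<kappa>' = \<kappa>' and C = 20])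
    fix t :: real assume "t \<ge> 0"
    define r where "r = exp (- t)"
    have r: "0 < r" "r \<le> 1" using \<open>t \<ge> 0\<close> by (auto simp: r_def)
    have p: "1 / 16 \<le> cov_det r" using r by (intro cov_det_lower) auto
    then have p0: "cov_det r > 0" by simp
    define z where "z = r^2"
    have z: "0 < z" "z \<le> 1" using r power_le_one [of r 2] by (auto simp: z_def)
    have zz: "z^2 \<le> z" using z by (simp add: power2_eq_square mult_left_le)
    have rz: "r^4 = z^2" "r^6 = z^3" "r^2 = z" by (simp_all add: z_def flip: power_mult)
    define w where "w = 5 - 4 * z + z^2"
    have w: "2 \<le> w" "w \<le> 5"
    proof -
      have "0 \<le> (1 - z) * (3 - z)" using z by (intro mult_nonneg_nonneg) auto
      then show "2 \<le> w" by (simp add: w_def power2_eq_square algebra_simps)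
      show "w \<le> 5" using zz z unfolding w_def by linarith
    qed
    have x: "(vel11 t - vel22 t) / 2 = z * w / (32 * cov_det r)"
      using p0 unfolding vel11_def vel22_def r_def [symmetric] rz w_def
      by (simp add: field_simps power2_eq_square)
    have m: "(vel11 t + vel22 t) / 2 = z * (5 + 4 * z - 3 * z^2) / (32 * cov_det r)"
      using p0 unfolding vel11_def vel22_def r_def [symmetric] rz
      by (simp add: field_simps power2_eq_square)
    have \<kappa>: "\<kappa> t = - 4 * r / w" "\<kappa>' t = 4 * r * (5 + 4 * z - 3 * z^2) / w^2"
      unfolding \<kappa>_def \<kappa>'_def r_def [symmetric] rz w_def by simp_all
    show "(\<kappa> has_real_derivative \<kappa>' t) (at t within {0..})"
      unfolding \<kappa>_def [abs_def] \<kappa>'_def using w_pos [of "exp (- t)"]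
      by (auto intro!: derivative_eq_intros simp: power2_eq_square)
        (simp add: field_simps eval_nat_numeral, simp add: minus_divide_left del: divide_minus_left)
    show "vel12 t = (vel11 t - vel22 t) / 2 * \<kappa> t"
      unfolding x \<kappa> vel12_def r_def [symmetric] using p0 w r
      by (simp add: field_simps z_def eval_nat_numeral)
    have dp: "a / (32 * cov_det r) \<le> a / 2" if "0 \<le> a" for a
      using that p by (intro divide_left_mono) auto
    have n: "2 \<le> 5 + 4 * z - 3 * z^2" "5 + 4 * z - 3 * z^2 \<le> 9"
      using z zz zero_le_power2 [of z] by linarith+
    have zw: "z * w \<le> 1 * 5" using z w by (intro mult_mono) auto
    have "1 + (\<kappa> t)\<^sup>2 \<le> 5"
    proof -
      have "16 * z \<le> 4 * w^2"
        using z w mult_mono [of 2 w 2 w] by (auto simp: power2_eq_square)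
      then show ?thesis
        using w unfolding \<kappa> by (simp add: power_divide power_mult_distrib rz divide_le_eq)
    qed
    then have "z * w / (32 * cov_det r) * (1 + (\<kappa> t)\<^sup>2) \<le> 5 / 2 * 5" (is "?l \<le> _")
      using dp [of "z * w"] zw z w p0 by (intro mult_mono) auto
    then have "?l \<le> 20" by (rule order_trans) simp
    then show "0 < (vel11 t - vel22 t) / 2 \<and> (vel11 t - vel22 t) / 2 * (1 + (\<kappa> t)\<^sup>2) \<le> 20"
      unfolding x using z w p0 by (intro conjI divide_pos_pos mult_pos_pos) auto
    have "z * (5 + 4 * z - 3 * z^2) \<le> 1 * 9" using z n by (intro mult_mono) auto
    then show "0 \<le> (vel11 t + vel22 t) / 2 \<and> (vel11 t + vel22 t) / 2 \<le> 20"
      unfolding m using z n p0 dp [of "z * (5 + 4 * z - 3 * z^2)"] by (auto intro!: divide_nonneg_pos mult_nonneg_nonneg)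
    have "4 * r * (5 + 4 * z - 3 * z^2) \<le> 4 * 9" using r n by (intro mult_mono) auto
    also have "\<dots> \<le> 20 * (2 * 2)" by simp
    also have "\<dots> \<le> 20 * (w * w)" using w by (intro mult_left_mono mult_mono) auto
    finally show "0 < \<kappa>' t \<and> \<kappa>' t \<le> 20"
      unfolding \<kappa> using r n w by (auto simp: divide_le_eq power2_eq_square intro!: divide_pos_pos mult_pos_pos)
  qed
qed


section \<open>The velocity field\<close>

lemma integral_lborel_translate:
  fixes F :: "'a::euclidean_space \<Rightarrow> real"
  assumes "F \<in> borel_measurable borel"
  shows "(\<integral>y. F (y + c) \<partial>lborel) = (\<integral>y. F y \<partial>lborel)"
proof -
  have "(\<integral>y. F y \<partial>lborel) = (\<integral>y. F y \<partial>distr lborel borel ((+) c))"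
    by (simp only: lborel_distr_plus)
  also have "\<dots> = (\<integral>y. F (c + y) \<partial>lborel)"
    using assms by (intro integral_distr) auto
  finally show ?thesis by (simp add: add.commute)
qed

text \<open>Completing the square in \<open>y\<close>: the translation by \<open>- (A + Q B Q)\<inverse> Q B E x\<close> removes the cross
  terms, where \<open>E = exp (- t A)\<close> and \<open>Q\<^sup>2 = 1 - E\<^sup>2\<close>.\<close>

lemma ou_semigroup_gaussian_tilt:
  assumes "t \<ge> 0"
  shows "ou_semigroup 2 mat_A t (gaussian_tilt 2 mat_B) (vec2 p) =
    exp (- (vel11 t * (fst p)\<^sup>2 + 2 * vel12 t * fst p * snd p + vel22 t * (snd p)\<^sup>2) / 2) *
    ou_semigroup 2 mat_A t (gaussian_tilt 2 mat_B) (vec2 0)"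
    and "ou_semigroup 2 mat_A t (gaussian_tilt 2 mat_B) (vec2 0) > 0"
proof -
  define r where "r = exp (- t)"
  define a where "a = sqrt (1 - r^2)"
  define b where "b = sqrt (1 - r^4)"
  have r: "0 < r" "r \<le> 1" using \<open>t \<ge> 0\<close> by (auto simp: r_def)
  have a2: "a^2 = 1 - r^2" and b2: "b^2 = 1 - r^4"
    using r by (auto simp: a_def b_def power_le_one)
  have E: "mat_exp 2 ((- t) \<cdot>\<^sub>m mat_A) = mat2 r 0 0 (r^2)"
    by (simp add: mat_exp_diag r_def flip: exp_of_nat_mult)
  have Q: "mat_sqrt 2 (1\<^sub>m 2 - mat_exp 2 ((- 2 * t) \<cdot>\<^sub>m mat_A)) = mat2 a 0 0 b"
  proof -
    have "mat_exp 2 ((- 2 * t) \<cdot>\<^sub>m mat_A) = mat2 (r^2) 0 0 (r^4)"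
      by (simp add: mat_exp_diag r_def flip: exp_of_nat_mult)
    then show ?thesis
      using r by (simp add: mat_sqrt_diag a_def b_def power_le_one)
  qed
  define e where "e = cov_det r"
  have e: "e > 0" using cov_det_lower [of r] r unfolding e_def by auto
  have e_eq: "e = 1 / 2 - 5 / 16 * r^2 - r^4 / 8 + r^6 / 16" by (simp add: e_def cov_det_def)
  define F where "F p y = mu_density y *
    gaussian_tilt 2 mat_B (vec2 (r * fst p + a * fst y, r^2 * snd p + b * snd y))" for p y
  have F_eq: "F p y = sqrt 2 / pi * exp (- (((fst y)\<^sup>2 + 2 * (snd y)\<^sup>2) +
      (2 * (r * fst p + a * fst y)\<^sup>2 - 2 * (r * fst p + a * fst y) * (r^2 * snd p + b * snd y) +
        (r^2 * snd p + b * snd y)\<^sup>2)) / 2)" for p y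
    unfolding F_def mu_density_def gaussian_tilt_def
    by (simp add: power2_eq_square field_simps flip: exp_add)
  have F_meas [measurable]: "F p \<in> borel_measurable borel" for p
    unfolding F_eq [abs_def] by (intro borel_measurable_continuous_onI continuous_intros) auto
  have ou: "ou_semigroup 2 mat_A t (gaussian_tilt 2 mat_B) (vec2 p) = (\<integral>y. F p y \<partial>lborel)" for p
  proof -
    let ?g = "\<lambda>y. gaussian_tilt 2 mat_B (mat2 r 0 0 (r^2) *\<^sub>v vec2 p + mat2 a 0 0 b *\<^sub>v y)"
    have g: "?g (vec2 y) = gaussian_tilt 2 mat_B (vec2 (r * fst p + a * fst y, r^2 * snd p + b * snd y))" for y
      by simp
    have g_borel: "(\<lambda>y. ?g (vec2 y)) \<in> borel_measurable borel"
      unfolding g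
      by (intro measurable_compose [OF _ measurable_compose [OF measurable_vec2 measurable_tilt]]
          borel_measurable_continuous_onI continuous_intros)
    have "ou_semigroup 2 mat_A t (gaussian_tilt 2 mat_B) (vec2 p) = (\<integral>y. ?g y \<partial>gaussian_vec 2 mat_A)"
      unfolding ou_semigroup_def E Q ..
    also have "\<dots> = (\<integral>y. ?g (vec2 y) \<partial>density lborel (\<lambda>p. ennreal (mu_density p)))"
      unfolding mu_eq
      by (rule integral_distr [OF _ measurable_lborel_vec_2I]) (simp, rule g_borel)
    also have "\<dots> = (\<integral>y. mu_density y *\<^sub>R ?g (vec2 y) \<partial>lborel)"
      using g_borel by (intro integral_density) (auto simp: mu_density_pos less_imp_le)
    also have "\<dots> = (\<integral>y. F p y \<partial>lborel)"
      unfolding g F_def by simp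
    finally show ?thesis .
  qed
  \<comment> \<open>D = det (A + Q B Q), the denominator of the translation s.\<close>
  define D where "D = 2 + b\<^sup>2 + 4 * a\<^sup>2 + a\<^sup>2 * b\<^sup>2"
  have D_e: "D = 16 * e"
    unfolding D_def a2 b2 e_eq by (simp add: field_simps flip: power_add)
  have D: "D > 0" using e by (simp add: D_e)
  define s where "s p = (a * ((4 + b\<^sup>2) * (r * fst p) - 2 * (r\<^sup>2 * snd p)) / D,
      b * ((1 + a\<^sup>2) * (r\<^sup>2 * snd p) - r * fst p) / D)" for p
  have square: "F p (y + - s p) =
      exp (- (vel11 t * (fst p)\<^sup>2 + 2 * vel12 t * fst p * snd p + vel22 t * (snd p)\<^sup>2) / 2) * F 0 y" for p y
  proof -
    obtain p1 p2 y1 y2 where eqs: "p = (p1, p2)" "y = (y1, y2)" by fastforce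
    define u v where "u = r * p1" and "v = r\<^sup>2 * p2"
    define s1 where "s1 = a * ((4 + b\<^sup>2) * u - 2 * v) / D"
    define s2 where "s2 = b * ((1 + a\<^sup>2) * v - u) / D"
    have sp: "y + - s p = (y1 - s1, y2 - s2)"
      by (simp add: s_def s1_def s2_def u_def v_def eqs)
    \<comment> \<open>The relations \<open>H1\<close> and \<open>H2\<close> below are the two rows
      of (A + Q B Q) s = Q B E p; multiplying by D keeps their verification polynomial.\<close>
    have s_mult: "s1 * D = a * ((4 + b\<^sup>2) * u - 2 * v)" "s2 * D = b * ((1 + a\<^sup>2) * v - u)"
      using D by (simp_all add: s1_def s2_def)
    have "((1 + 2 * a\<^sup>2) * s1 - a * b * s2 - a * (2 * u - v)) * D =
        (1 + 2 * a\<^sup>2) * (s1 * D) - a * b * (s2 * D) - a * (2 * u - v) * D"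
      by (simp add: algebra_simps)
    also have "\<dots> = 0" unfolding s_mult unfolding D_def by (simp add: power2_eq_square algebra_simps)
    finally have H1: "(1 + 2 * a\<^sup>2) * s1 - a * b * s2 - a * (2 * u - v) = 0" using D by simp
    have "((2 + b\<^sup>2) * s2 - a * b * s1 - b * (v - u)) * D =
        (2 + b\<^sup>2) * (s2 * D) - a * b * (s1 * D) - b * (v - u) * D"
      by (simp add: algebra_simps)
    also have "\<dots> = 0" unfolding s_mult unfolding D_def by (simp add: power2_eq_square algebra_simps)
    finally have H2: "(2 + b\<^sup>2) * s2 - a * b * s1 - b * (v - u) = 0" using D by simp
    define c where "c = 2 * u\<^sup>2 - 2 * u * v + v\<^sup>2 - (a * s1 * (2 * u - v) + b * s2 * (v - u))"
    \<comment> \<open>Arranged so that everything coupling y to p carries the left side of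
      \<open>H1\<close> or \<open>H2\<close> as a factor.\<close>
    have "(y1 - s1)\<^sup>2 + 2 * (y2 - s2)\<^sup>2 + (2 * (u + a * (y1 - s1))\<^sup>2 -
          2 * (u + a * (y1 - s1)) * (v + b * (y2 - s2)) + (v + b * (y2 - s2))\<^sup>2) =
        y1\<^sup>2 + 2 * y2\<^sup>2 + (2 * (a * y1)\<^sup>2 - 2 * (a * y1) * (b * y2) + (b * y2)\<^sup>2) + c
        + (s1 - 2 * y1) * ((1 + 2 * a\<^sup>2) * s1 - a * b * s2 - a * (2 * u - v))
        + (s2 - 2 * y2) * ((2 + b\<^sup>2) * s2 - a * b * s1 - b * (v - u))"
      unfolding c_def by (simp add: power2_eq_square algebra_simps)
    then have expand: "(y1 - s1)\<^sup>2 + 2 * (y2 - s2)\<^sup>2 + (2 * (u + a * (y1 - s1))\<^sup>2 -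
          2 * (u + a * (y1 - s1)) * (v + b * (y2 - s2)) + (v + b * (y2 - s2))\<^sup>2) =
        y1\<^sup>2 + 2 * y2\<^sup>2 + (2 * (a * y1)\<^sup>2 - 2 * (a * y1) * (b * y2) + (b * y2)\<^sup>2) + c"
      unfolding H1 H2 by simp
    have "c * D = (2 * u\<^sup>2 - 2 * u * v + v\<^sup>2) * D -
        (a * (s1 * D) * (2 * u - v) + b * (s2 * D) * (v - u))"
      unfolding c_def by (simp add: algebra_simps)
    also have "\<dots> = (4 + b\<^sup>2) * u\<^sup>2 - 4 * u * v + (2 + 2 * a\<^sup>2) * v\<^sup>2"
      unfolding s_mult unfolding D_def by (simp add: power2_eq_square algebra_simps)
    also have "\<dots> = (5 - r^4) * u\<^sup>2 - 4 * u * v + (4 - 2 * r^2) * v\<^sup>2"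
      unfolding a2 b2 by simp
    finally have "c = ((5 - r^4) * u\<^sup>2 - 4 * u * v + (4 - 2 * r^2) * v\<^sup>2) / D"
      using D by (simp add: field_simps)
    also have "\<dots> = vel11 t * p1\<^sup>2 + 2 * vel12 t * p1 * p2 + vel22 t * p2\<^sup>2"
      using e unfolding D_e vel11_def vel12_def vel22_def r_def [symmetric] e_def [symmetric] u_def v_def
      by (simp add: field_simps eval_nat_numeral)
    finally have c_vel: "vel11 t * p1\<^sup>2 + 2 * vel12 t * p1 * p2 + vel22 t * p2\<^sup>2 = c" ..
    show ?thesis
      unfolding sp unfolding eqs F_eq fst_conv snd_conv c_vel u_def [symmetric] v_def [symmetric] expand
      by (simp add: algebra_simps add_divide_distrib diff_divide_distrib flip: exp_add)
  qed
  have "(\<integral>y. F p y \<partial>lborel) =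
      exp (- (vel11 t * (fst p)\<^sup>2 + 2 * vel12 t * fst p * snd p + vel22 t * (snd p)\<^sup>2) / 2) * (\<integral>y. F 0 y \<partial>lborel)" for p
    using integral_lborel_translate [OF F_meas [of p], of "- s p"] unfolding square by simp
  then show "ou_semigroup 2 mat_A t (gaussian_tilt 2 mat_B) (vec2 p) =
    exp (- (vel11 t * (fst p)\<^sup>2 + 2 * vel12 t * fst p * snd p + vel22 t * (snd p)\<^sup>2) / 2) *
    ou_semigroup 2 mat_A t (gaussian_tilt 2 mat_B) (vec2 0)"
    unfolding ou .
  have F0_pos: "0 < F 0 y" for y unfolding F_eq by simp
  have "integrable lborel (F 0)"
  proof (rule Bochner_Integration.integrable_bound)
    interpret prob_space "density lborel (\<lambda>p. ennreal (mu_density p))" by (rule prob_space_mu_density)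
    have "integrable (density lborel (\<lambda>p. ennreal (mu_density p))) (\<lambda>_. 2 :: real)" by simp
    then show "integrable lborel (\<lambda>y. mu_density y *\<^sub>R (2 :: real))"
      by (subst (asm) integrable_density) (auto simp: mu_density_pos less_imp_le)
    have nonneg: "0 \<le> 2 * u\<^sup>2 - 2 * u * v + v\<^sup>2" for u v :: real
    proof -
      have "2 * u\<^sup>2 - 2 * u * v + v\<^sup>2 = u\<^sup>2 + (u - v)\<^sup>2" by (simp add: power2_eq_square algebra_simps)
      also have "\<dots> \<ge> 0" by simp
      finally show ?thesis .
    qed
    have "vec2 q \<bullet> (mat_B *\<^sub>v vec2 q) = 2 * (fst q)\<^sup>2 - 2 * fst q * snd q + (snd q)\<^sup>2" for q
      by (simp add: power2_eq_square algebra_simps)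
    then have "gaussian_tilt 2 mat_B (vec2 q) \<le> 2" for q
      unfolding gaussian_tilt_def using nonneg [of "fst q" "snd q"] by simp
    then have "F 0 y \<le> mu_density y * 2" for y
      unfolding F_def using mu_density_pos [of y] by (intro mult_left_mono) auto
    then show "AE y in lborel. norm (F 0 y) \<le> norm (mu_density y *\<^sub>R (2 :: real))"
      using F0_pos mu_density_pos by (intro AE_I2) (simp add: less_imp_le)
  qed simp
  moreover have "\<not> (AE y in lborel. F 0 y = 0)"
  proof
    assume "AE y in lborel. F 0 y = 0"
    then have "AE y in (lborel :: (real \<times> real) measure). False"
      by eventually_elim (use F0_pos in \<open>auto simp: less_le\<close>)
    then show False using closed_AE_lborel_imp_all [of "\<lambda>_. False"] by simp
  qed
  ultimately have "0 \<noteq> (\<integral>y. F 0 y \<partial>lborel)"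
    using integral_nonneg_eq_0_iff_AE [of lborel "F 0"] F0_pos by (auto simp: less_imp_le)
  moreover have "0 \<le> (\<integral>y. F 0 y \<partial>lborel)" using F0_pos by (intro Bochner_Integration.integral_nonneg) (auto simp: less_imp_le)
  ultimately show "ou_semigroup 2 mat_A t (gaussian_tilt 2 mat_B) (vec2 0) > 0"
    unfolding ou by simp
qed

lemma heat_velocity_eq:
  assumes "t \<ge> 0"
  shows "heat_velocity 2 mat_A (gaussian_tilt 2 mat_B) t (vec2 p) =
    vec2 (vel11 t * fst p + vel12 t * snd p, vel12 t * fst p + vel22 t * snd p)"
proof -
  let ?P = "ou_semigroup 2 mat_A t (gaussian_tilt 2 mat_B)"
  have "ln (?P (vec2 p)) = ln (?P (vec2 0)) +
      (- vel11 t * (fst p)\<^sup>2 + 2 * - vel12 t * fst p * snd p + - vel22 t * (snd p)\<^sup>2) / 2" for p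
    unfolding ou_semigroup_gaussian_tilt(1) [OF assms, of p]
    using ou_semigroup_gaussian_tilt(2) [OF assms] by (subst ln_mult) (auto simp: field_simps)
  from gradient_quadratic [of "\<lambda>v. ln (?P v)", OF this]
  show ?thesis unfolding heat_velocity_def by (simp add: algebra_simps)
qed


section \<open>Kim-Milman maps of linear flows\<close>

text \<open>Coordinate projections are continuous in the product topology used for the padded
  vectors.\<close>

lemma compact_vec_2_bounded:
  assumes "compact_vec 2 K"
  obtains R where "0 \<le> R" "\<And>p. vec2 p \<in> K \<Longrightarrow> \<bar>fst p\<bar> \<le> R \<and> \<bar>snd p\<bar> \<le> R"
proof -
  let ?pad = "\<lambda>(v :: real vec) i. if i < 2 then v $ i else 0"
  have "\<exists>R. \<forall>v\<in>K. \<bar>v $ i\<bar> \<le> R" if "i < 2" for i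
  proof -
    have "compact ((\<lambda>f. f i) ` ?pad ` K)"
      using assms unfolding compact_vec_def
      by (intro compact_continuous_image continuous_on_subset [OF continuous_on_product_coordinates]) auto
    then have "bounded ((\<lambda>v. v $ i) ` K)"
      using that by (simp add: image_image compact_imp_bounded)
    then show ?thesis by (auto simp: bounded_iff)
  qed
  from this [of 0] this [of 1] obtain R R' where R: "\<forall>v\<in>K. \<bar>v $ 0\<bar> \<le> R" "\<forall>v\<in>K. \<bar>v $ Suc 0\<bar> \<le> R'"
    by auto
  show thesis
  proof (rule that [of "max 0 (max R R')"])
    fix p assume "vec2 p \<in> K"
    with R have "\<bar>fst p\<bar> \<le> R" "\<bar>snd p\<bar> \<le> R'" by force+
    then show "\<bar>fst p\<bar> \<le> max 0 (max R R') \<and> \<bar>snd p\<bar> \<le> max 0 (max R R')" by auto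
  qed auto
qed

lemma compact_vec_sing: "x \<in> carrier_vec n \<Longrightarrow> compact_vec n {x}"
  by (simp add: compact_vec_def)

lemma inverse_2x2:
  fixes u1 u2 v1 v2 x y :: real
  assumes "\<delta> = u1 * v2 - u2 * v1" "\<delta> \<noteq> 0"
  shows "(v2 / \<delta> * x + - u2 / \<delta> * y) * u1 + (- v1 / \<delta> * x + u1 / \<delta> * y) * u2 = x"
    and "(v2 / \<delta> * x + - u2 / \<delta> * y) * v1 + (- v1 / \<delta> * x + u1 / \<delta> * y) * v2 = y"
    and "v2 / \<delta> * (x * u1 + y * u2) + - u2 / \<delta> * (x * v1 + y * v2) = x"
    and "- v1 / \<delta> * (x * u1 + y * u2) + u1 / \<delta> * (x * v1 + y * v2) = y"
  using assms(2) by (simp_all add: field_simps) (simp_all add: assms(1) algebra_simps)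

text \<open>One direction supplies existence; the other makes the limit map unique on
  \<open>carrier_vec 2\<close>, as needed for a claim about all Kim-Milman maps.\<close>

lemma kim_milman_map_linear_flow_iff:
  assumes vel: "\<And>t p. t \<ge> 0 \<Longrightarrow> heat_velocity 2 A f t (vec2 p) =
      vec2 (m11 t * fst p + m12 t * snd p, m12 t * fst p + m22 t * snd p)"
    and sol: "planar_solution m11 m12 m22 u1 v1" "planar_solution m11 m12 m22 u2 v2"
    and init: "u1 0 = 1" "v1 0 = 0" "u2 0 = 0" "v2 0 = 1"
    and det: "\<And>t. t \<ge> 0 \<Longrightarrow> u1 t * v2 t - u2 t * v1 t \<noteq> 0"
    and lim: "(u1 \<longlongrightarrow> a) at_top" "(u2 \<longlongrightarrow> b) at_top" "(v1 \<longlongrightarrow> c) at_top" "(v2 \<longlongrightarrow> d) at_top"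
    and nz: "a * d - b * c \<noteq> 0"
  shows "is_kim_milman_map 2 A f T \<longleftrightarrow> T \<in> carrier_vec 2 \<rightarrow> carrier_vec 2 \<and>
    (\<forall>p. T (vec2 p) = vec2 (d / (a * d - b * c) * fst p + - b / (a * d - b * c) * snd p,
      - c / (a * d - b * c) * fst p + a / (a * d - b * c) * snd p))"
    (is "_ \<longleftrightarrow> _ \<and> (\<forall>p. T (vec2 p) = vec2 (?T p))")
proof -
  define \<Delta> where "\<Delta> t = u1 t * v2 t - u2 t * v1 t" for t
  define S where "S t p = (fst p * u1 t + snd p * u2 t, fst p * v1 t + snd p * v2 t)"
    for t and p :: "real \<times> real"
  define G where "G t p = (v2 t / \<Delta> t * fst p + - u2 t / \<Delta> t * snd p,
    - v1 t / \<Delta> t * fst p + u1 t / \<Delta> t * snd p)" for t and p :: "real \<times> real"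
  have \<Delta>_nz: "\<Delta> t \<noteq> 0" if "t \<ge> 0" for t using det [OF that] by (simp add: \<Delta>_def)
  have SG: "S t (G t p) = p" and GS: "G t (S t p) = p" if "t \<ge> 0" for t p
    using inverse_2x2 [OF \<Delta>_def \<Delta>_nz [OF that]] unfolding S_def G_def by simp_all
  have inv: "inv_into (carrier_vec 2) (S' t) (vec2 p) = vec2 (G t p)"
    if "t \<ge> 0" "\<And>p. S' t (vec2 p) = vec2 (S t p)" for S' t p
  proof (rule inv_into_f_eq)
    show "inj_on (S' t) (carrier_vec 2)"
    proof (rule inj_onI)
      fix x y assume xy: "x \<in> carrier_vec 2" "y \<in> carrier_vec 2" "S' t x = S' t y"
      then obtain p q where "x = vec2 p" "y = vec2 q" by (metis carrier_vec_2_cases)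
      with xy(3) that have "S t p = S t q" by simp
      with GS [OF \<open>t \<ge> 0\<close>] have "p = q" by metis
      then show "x = y" by (simp add: \<open>x = vec2 p\<close> \<open>y = vec2 q\<close>)
    qed
    show "S' t (vec2 (G t p)) = vec2 p" using that SG by simp
  qed simp
  have lim_\<Delta>: "(\<Delta> \<longlongrightarrow> a * d - b * c) at_top"
    unfolding \<Delta>_def [abs_def] by (intro tendsto_intros lim)
  have lim_inv: "((\<lambda>t. v2 t / \<Delta> t) \<longlongrightarrow> d / (a * d - b * c)) at_top"
      "((\<lambda>t. - u2 t / \<Delta> t) \<longlongrightarrow> - b / (a * d - b * c)) at_top"
      "((\<lambda>t. - v1 t / \<Delta> t) \<longlongrightarrow> - c / (a * d - b * c)) at_top"
      "((\<lambda>t. u1 t / \<Delta> t) \<longlongrightarrow> a / (a * d - b * c)) at_top"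
    by (intro tendsto_intros lim lim_\<Delta> nz)+
  have flow_S: "is_flow_vec 2 (heat_velocity 2 A f) (\<lambda>t v. vec2 (S t (v $ 0, v $ Suc 0)))"
    unfolding is_flow_vec_def ball_carrier_vec_2
  proof (intro allI impI conjI)
    fix p :: "real \<times> real"
    show "vec2 (S 0 (vec2 p $ 0, vec2 p $ Suc 0)) = vec2 p"
      using init by (simp add: S_def)
    fix t :: real and i :: nat assume "t \<ge> 0" "i < 2"
    then show "((\<lambda>s. vec2 (S s (vec2 p $ 0, vec2 p $ Suc 0)) $ i) has_real_derivative
        heat_velocity 2 A f t (vec2 (S t (vec2 p $ 0, vec2 p $ Suc 0))) $ i) (at t within {0..})"
      using planar_solution_lincomb [OF sol, of "fst p" "snd p"]
      unfolding planar_solution_def vel [OF \<open>t \<ge> 0\<close>] less_2_cases_iff by (auto simp: S_def)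
  qed simp
  \<comment> \<open>The definition only asks for some flow; every flow has the explicit values at
    times t \<ge> 0, which also fixes \<open>inv_into\<close> there.\<close>
  have flow_unique: "S' t (vec2 p) = vec2 (S t p)"
    if S': "is_flow_vec 2 (heat_velocity 2 A f) S'" and "t \<ge> 0" for S' t p
  proof -
    note flow = S' [unfolded is_flow_vec_def ball_carrier_vec_2, rule_format, of p]
    have "planar_solution m11 m12 m22 (\<lambda>t. S' t (vec2 p) $ 0) (\<lambda>t. S' t (vec2 p) $ Suc 0)"
      unfolding planar_solution_def
    proof (intro allI impI)
      fix t :: real assume "t \<ge> 0"
      then obtain q where q: "S' t (vec2 p) = vec2 q" using flow by (metis carrier_vec_2_cases)
      have "((\<lambda>s. S' s (vec2 p) $ i) has_real_derivative
          vec2 (m11 t * fst q + m12 t * snd q, m12 t * fst q + m22 t * snd q) $ i) (at t within {0..})"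
        if "i < 2" for i
        using flow \<open>t \<ge> 0\<close> that by (simp flip: vel q)
      from this [of 0] this [of 1]
      show "((\<lambda>t. S' t (vec2 p) $ 0) has_real_derivative
            m11 t * S' t (vec2 p) $ 0 + m12 t * S' t (vec2 p) $ Suc 0) (at t within {0..}) \<and>
          ((\<lambda>t. S' t (vec2 p) $ Suc 0) has_real_derivative
            m12 t * S' t (vec2 p) $ 0 + m22 t * S' t (vec2 p) $ Suc 0) (at t within {0..})"
        by (simp add: q)
    qed
    from planar_solution_unique [OF sol init det this \<open>t \<ge> 0\<close>]
    show ?thesis
      using flow \<open>t \<ge> 0\<close> by (intro vec2_eqI) (auto simp: S_def mult.commute)
  qed
  show ?thesis
  proof (intro iffI conjI allI)
    assume T: "is_kim_milman_map 2 A f T"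
    then show T_carrier: "T \<in> carrier_vec 2 \<rightarrow> carrier_vec 2" by (simp add: is_kim_milman_map_def)
    obtain S' where flow: "is_flow_vec 2 (heat_velocity 2 A f) S'"
      and ul: "\<And>K. compact_vec 2 K \<Longrightarrow> uniform_limit K
        (\<lambda>t x. vec_norm2 (inv_into (carrier_vec 2) (S' t) x - T x)) (\<lambda>_. 0) at_top"
      using T unfolding is_kim_milman_map_def by blast
    fix p
    obtain q where q: "T (vec2 p) = vec2 q"
      using T_carrier by (metis Pi_mem carrier_vec_2_cases vec2_carrier(1))
    \<comment> \<open>Uniform convergence on the compact singleton gives the pointwise limit that
      determines T.\<close>
    have "((\<lambda>t. vec_norm2 (inv_into (carrier_vec 2) (S' t) (vec2 p) - T (vec2 p))) \<longlongrightarrow> 0) at_top"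
      using tendsto_uniform_limitI [OF ul [OF compact_vec_sing [of "vec2 p"]]] by simp
    moreover have "\<forall>\<^sub>F t in at_top.
        vec_norm2 (inv_into (carrier_vec 2) (S' t) (vec2 p) - T (vec2 p)) = norm (G t p - q)"
      using eventually_ge_at_top [of 0]
      by eventually_elim (simp add: q inv [of _ S'] flow_unique [OF flow])
    ultimately have "((\<lambda>t. norm (G t p - q)) \<longlongrightarrow> 0) at_top"
      by (rule Lim_transform_eventually)
    then have "((\<lambda>t. G t p) \<longlongrightarrow> q) at_top"
      by (simp add: tendsto_norm_zero_iff LIM_zero_iff)
    moreover have "((\<lambda>t. G t p) \<longlongrightarrow> ?T p) at_top"
      unfolding G_def by (intro tendsto_intros lim_inv)
    ultimately have "q = ?T p" by (intro tendsto_unique [of at_top]) auto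
    then show "T (vec2 p) = vec2 (?T p)" by (simp add: q)
  next
    assume T: "T \<in> carrier_vec 2 \<rightarrow> carrier_vec 2 \<and> (\<forall>p. T (vec2 p) = vec2 (?T p))"
    let ?S = "\<lambda>t v. vec2 (S t (v $ 0, v $ Suc 0))"
    have bij: "bij_betw (?S t) (carrier_vec 2) (carrier_vec 2)" if "t \<ge> 0" for t
      by (rule bij_betw_byWitness [where f' = "\<lambda>v. vec2 (G t (v $ 0, v $ Suc 0))"])
        (auto simp: SG GS that)
    have "uniform_limit K (\<lambda>t x. vec_norm2 (inv_into (carrier_vec 2) (?S t) x - T x)) (\<lambda>_. 0) at_top"
      if K: "compact_vec 2 K" for K
    proof (rule uniform_limitI)
      fix e :: real assume "e > 0"
      obtain R where R: "0 \<le> R" "\<And>p. vec2 p \<in> K \<Longrightarrow> \<bar>fst p\<bar> \<le> R \<and> \<bar>snd p\<bar> \<le> R"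
        by (rule compact_vec_2_bounded [OF K]) blast
      have norm_diff_le: "norm (z - w) \<le> \<bar>fst z - fst w\<bar> + \<bar>snd z - snd w\<bar>" for z w :: "real \<times> real"
        using norm_Pair_le [of "fst z - fst w" "snd z - snd w"] by (cases z, cases w) simp
      \<comment> \<open>The sum of the entrywise errors of the inverse matrix, times R, bounds the
        error at every point of K at once.\<close>
      define \<epsilon> where "\<epsilon> t = (\<bar>v2 t / \<Delta> t - d / (a * d - b * c)\<bar> + \<bar>- u2 t / \<Delta> t - - b / (a * d - b * c)\<bar> +
        (\<bar>- v1 t / \<Delta> t - - c / (a * d - b * c)\<bar> + \<bar>u1 t / \<Delta> t - a / (a * d - b * c)\<bar>)) * R" for t
      have "(\<epsilon> \<longlongrightarrow> (0 + 0 + (0 + 0)) * R) at_top"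
        unfolding \<epsilon>_def [abs_def]
        by (intro tendsto_intros tendsto_rabs_zero LIM_zero lim_inv)
      then have "\<forall>\<^sub>F t in at_top. \<epsilon> t < e"
        using \<open>e > 0\<close> by (intro order_tendstoD) auto
      then show "\<forall>\<^sub>F t in at_top. \<forall>x\<in>K. dist (vec_norm2 (inv_into (carrier_vec 2) (?S t) x - T x)) 0 < e"
        using eventually_ge_at_top [of 0]
      proof (eventually_elim, intro ballI)
        fix t :: real and x assume "\<epsilon> t < e" "0 \<le> t" "x \<in> K"
        have "x \<in> carrier_vec 2" using K \<open>x \<in> K\<close> by (auto simp: compact_vec_def)
        then obtain p where x: "x = vec2 p" by (rule carrier_vec_2_cases)
        have pR: "\<bar>fst p\<bar> \<le> R" "\<bar>snd p\<bar> \<le> R" using R(2) \<open>x \<in> K\<close> x by auto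
        have row: "\<bar>(k * fst p + l * snd p) - (k' * fst p + l' * snd p)\<bar> \<le> (\<bar>k - k'\<bar> + \<bar>l - l'\<bar>) * R"
          for k l k' l' :: real
        proof -
          have "(k * fst p + l * snd p) - (k' * fst p + l' * snd p) = (k - k') * fst p + (l - l') * snd p"
            by (simp add: algebra_simps)
          also have "\<bar>\<dots>\<bar> \<le> \<bar>k - k'\<bar> * \<bar>fst p\<bar> + \<bar>l - l'\<bar> * \<bar>snd p\<bar>"
            unfolding abs_mult [symmetric] by (rule abs_triangle_ineq)
          also have "\<dots> \<le> \<bar>k - k'\<bar> * R + \<bar>l - l'\<bar> * R"
            using pR by (intro add_mono mult_left_mono) auto
          finally show ?thesis by (simp add: distrib_right)
        qed
        have "inv_into (carrier_vec 2) (?S t) (vec2 p) = vec2 (G t p)"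
          using inv [of t ?S p] \<open>0 \<le> t\<close> by simp
        moreover have "T (vec2 p) = vec2 (?T p)" using T by blast
        ultimately have eq: "vec_norm2 (inv_into (carrier_vec 2) (?S t) x - T x) = norm (G t p - ?T p)"
          unfolding x by (simp only: vec2_arith vec_norm2_vec2)
        have "norm (G t p - ?T p) \<le> \<bar>fst (G t p) - fst (?T p)\<bar> + \<bar>snd (G t p) - snd (?T p)\<bar>"
          by (rule norm_diff_le)
        also have "\<dots> \<le> \<epsilon> t"
          unfolding \<epsilon>_def distrib_right [of _ _ R] G_def fst_conv snd_conv
          using add_mono [OF row row] by (simp only: distrib_right)
        finally show "dist (vec_norm2 (inv_into (carrier_vec 2) (?S t) x - T x)) 0 < e"
          using \<open>\<epsilon> t < e\<close> unfolding eq dist_real_def by simp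
      qed
    qed
    with T flow_S bij show "is_kim_milman_map 2 A f T"
      unfolding is_kim_milman_map_def by blast
  qed
qed


theorem mainTheorem1:
  shows "\<exists>(n::nat) (A::real mat) (B::real mat) (c\<^sub>0::real).
    n \<ge> 1 \<and> pos_def_mat n A \<and> pos_def_mat n B \<and> c\<^sub>0 > 0 \<and>
    (let \<mu> = gaussian_vec n A;
         f = gaussian_tilt c\<^sub>0 B;
         \<nu> = density \<mu> (\<lambda>x. ennreal (f x))
     in prob_space \<mu> \<and> prob_space \<nu> \<and>
        (\<exists>T. is_kim_milman_map n A f T) \<and>
        (\<exists>G. is_brenier_map n \<mu> \<nu> G) \<and>
        (\<forall>T G. is_kim_milman_map n A f T \<longrightarrow> is_brenier_map n \<mu> \<nu> G \<longrightarrow>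
           \<not> (AE x in \<mu>. T x = G x)))"
proof -
  obtain u1 v1 u2 v2 a b c d
    where sol: "planar_solution vel11 vel12 vel22 u1 v1" "planar_solution vel11 vel12 vel22 u2 v2"
    and init: "u1 0 = 1" "v1 0 = 0" "u2 0 = 0" "v2 0 = 1"
    and det: "\<And>t. t \<ge> 0 \<Longrightarrow> u1 t * v2 t - u2 t * v1 t \<noteq> 0"
    and lim: "(u1 \<longlongrightarrow> a) at_top" "(u2 \<longlongrightarrow> b) at_top" "(v1 \<longlongrightarrow> c) at_top" "(v2 \<longlongrightarrow> d) at_top"
    and nz: "a * d - b * c \<noteq> 0"
    by (rule heat_flow_exists) blast
  have "b < c" using sol init lim(2,3) by (rule heat_flow_limit_not_symmetric)
  define \<mu> where "\<mu> = gaussian_vec 2 mat_A"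
  define f where "f = gaussian_tilt 2 mat_B"
  define \<nu> where "\<nu> = density \<mu> (\<lambda>x. ennreal (f x))"
  let ?T = "\<lambda>p. (d / (a * d - b * c) * fst p + - b / (a * d - b * c) * snd p,
      - c / (a * d - b * c) * fst p + a / (a * d - b * c) * snd p)"
  have km: "is_kim_milman_map 2 mat_A f T \<longleftrightarrow>
      T \<in> carrier_vec 2 \<rightarrow> carrier_vec 2 \<and> (\<forall>p. T (vec2 p) = vec2 (?T p))" for T
    unfolding f_def using heat_velocity_eq sol init det lim nz by (rule kim_milman_map_linear_flow_iff)
  have pd: "pos_def_mat 2 mat_A" "pos_def_mat 2 mat_B"
  proof -
    have A: "0 < x * x + 2 * (y * y)" if "(x, y) \<noteq> 0" for x y :: real
    proof -
      have "0 < x * x + y * y" using that by (auto simp: sum_squares_gt_zero_iff zero_prod_def)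
      also have "\<dots> \<le> x * x + 2 * (y * y)" by simp
      finally show ?thesis .
    qed
    have B: "0 < 2 * (x * x) - 2 * (x * y) + y * y" if "(x, y) \<noteq> 0" for x y :: real
    proof -
      have "2 * (x * x) - 2 * (x * y) + y * y = x * x + (x - y) * (x - y)" by (simp add: algebra_simps)
      also have "\<dots> > 0" using that unfolding sum_squares_gt_zero_iff by (auto simp: zero_prod_def)
      finally show ?thesis .
    qed
    show "pos_def_mat 2 mat_A" "pos_def_mat 2 mat_B"
      unfolding pos_def_mat_def ball_carrier_vec_2 using A B by (auto simp: algebra_simps)
  qed
  have "is_kim_milman_map 2 mat_A f (\<lambda>v. vec2 (?T (v $ 0, v $ Suc 0)))"
    unfolding km by auto
  moreover have "\<exists>G. is_brenier_map 2 \<mu> \<nu> G"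
    unfolding \<mu>_def \<nu>_def f_def using brenier_map_exists by blast
  moreover have "\<not> (AE x in \<mu>. T x = G x)" if T: "is_kim_milman_map 2 mat_A f T" and G: "is_brenier_map 2 \<mu> \<nu> G" for T G
  proof
    assume TG: "AE x in \<mu>. T x = G x"
    obtain \<phi> where conv: "convex_fun_vec 2 \<phi>" and grad: "AE x in \<mu>. has_gradient_vec 2 \<phi> (G x) x"
      using G unfolding is_brenier_map_def by blast
    from grad TG have "AE x in \<mu>. has_gradient_vec 2 \<phi> (T x) x"
      by eventually_elim simp
    then have "AE p in lborel. has_gradient_vec 2 \<phi> (T (vec2 p)) (vec2 p)"
      unfolding \<mu>_def by (rule AE_mu_imp_AE_lborel)
    then have "AE p in lborel. has_gradient_vec 2 \<phi> (vec2 (?T p)) (vec2 p)"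
      using T unfolding km by simp
    \<comment> \<open>Inverting a 2x2 matrix negates and rescales the off-diagonal entries alike, so
      the asymmetry b < c of the limit of S passes to its inverse.\<close>
    then have "- b / (a * d - b * c) = - c / (a * d - b * c)"
      by (rule convex_gradient_linear_imp_symmetric [OF conv])
    with nz \<open>b < c\<close> show False by simp
  qed
  ultimately show ?thesis
    using pd prob_space_mu prob_space_nu unfolding Let_def \<mu>_def \<nu>_def f_def
    by (intro exI [of _ 2] exI [of _ mat_A] exI [of _ mat_B] exI [of _ "2::real"]) auto
qed

end
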